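(* There are exactly $4$ isomorphism classes of degree $2$ extensions of the dihedral group $D_8$ of order $8$. For $d\ge4$, there are exactly $5$ isomorphism classes of degree $2$ extensions $E=D\langle e\rangle$ of the dihedral group $D\cong D_{2^d}$ of order $2^d$, $D=\langle s,t\mid s^{2^{d-1}},t^2,(st)^2\rangle$. With $s_1:=s^{2^{d-2}}$ (the generator of $Z(D)$), these are: (a) $E=D\times\langle e\rangle$ where $e\in C_E(D)$ and $e^2=1$; (b) $E=D\langle e\rangle$ where $e\in C_E(D)$ and $e^2=s_1$; (c) $E=D_{2^{d+1}}$, a dihedral group of order $2^{d+1}$; (d) $E=SD_{2^{d+1}}$, a semidihedral group of order $2^{d+1}$; (e) $E=D\rtimes\langle e\rangle$ where $e^2=1$, $s^e=s_1s$, $t^e=t$.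
   Context: A degree $2$ extension of a group $D$ is a group $E$ containing $D$ as a subgroup of index $2$. $D_{2^n}$ denotes the dihedral group of order $2^n$. Notation: $x^e=e^{-1}xe$. *)

theory Defs
  imports "HOL-Algebra.Algebra"
begin

section \<open>Groups given by generators and relations\<close>

text \<open>A word is a list of letters; the letter \<open>(g, True)\<close> stands for the generator \<open>g\<close>
  and \<open>(g, False)\<close> for its inverse. The generators are all elements of the type \<open>'g\<close>.\<close>

type_synonym 'g word = "('g \<times> bool) list"

inductive pres_cong :: "'g word set \<Rightarrow> 'g word \<Rightarrow> 'g word \<Rightarrow> bool" for R :: "'g word set" where
  refl: "pres_cong R u u"
| sym: "pres_cong R u v \<Longrightarrow> pres_cong R v u"
| trans: "pres_cong R u v \<Longrightarrow> pres_cong R v w \<Longrightarrow> pres_cong R u w"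
| cancel: "pres_cong R (u @ [(g, b), (g, \<not> b)] @ v) (u @ v)"
| relator: "r \<in> R \<Longrightarrow> pres_cong R (u @ r @ v) (u @ v)"

definition word_class :: "'g word set \<Rightarrow> 'g word \<Rightarrow> 'g word set" where
  "word_class R w = {v. pres_cong R w v}"

definition presented_group :: "'g word set \<Rightarrow> 'g word set monoid" where
  "presented_group R =
    \<lparr>carrier = range (word_class R),
     monoid.mult = (\<lambda>A B. \<Union>a\<in>A. \<Union>b\<in>B. word_class R (a @ b)),
     monoid.one = word_class R []\<rparr>"

definition word_pow :: "'g word \<Rightarrow> nat \<Rightarrow> 'g word" where
  "word_pow w n = concat (replicate n w)"

section \<open>Dihedral and semidihedral 2-groups\<close>

datatype gen = S | T

text \<open>\<open>dihedral_group m\<close> and \<open>semidihedral_group m\<close> have order \<open>2^m\<close> (for \<open>m \<ge> 2\<close>, respectively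
  \<open>m \<ge> 4\<close>):
  \<open>D = \<langle>s, t | s^(2^(m-1)), t^2, (st)^2\<rangle>\<close> and
  \<open>SD = \<langle>s, t | s^(2^(m-1)), t^2, t^-1 s t = s^(2^(m-2)-1)\<rangle>\<close>.\<close>

definition dihedral_relators :: "nat \<Rightarrow> gen word set" where
  "dihedral_relators m =
    {word_pow [(S, True)] (2 ^ (m - 1)),
     word_pow [(T, True)] 2,
     word_pow [(S, True), (T, True)] 2}"

definition dihedral_group :: "nat \<Rightarrow> gen word set monoid" where
  "dihedral_group m = presented_group (dihedral_relators m)"

definition dihedral_gen :: "nat \<Rightarrow> gen \<Rightarrow> gen word set" where
  "dihedral_gen m g = word_class (dihedral_relators m) [(g, True)]"

definition semidihedral_group :: "nat \<Rightarrow> gen word set monoid" where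
  "semidihedral_group m = presented_group
    {word_pow [(S, True)] (2 ^ (m - 1)),
     word_pow [(T, True)] 2,
     [(T, False), (S, True), (T, True)] @ word_pow [(S, False)] (2 ^ (m - 2) - 1)}"

definition dihedral_gens :: "nat \<Rightarrow> 'a monoid \<Rightarrow> 'a set \<Rightarrow> 'a \<Rightarrow> 'a \<Rightarrow> bool" where
  "dihedral_gens m E D s t \<longleftrightarrow>
    (\<exists>\<phi> \<in> iso (dihedral_group m) (E\<lparr>carrier := D\<rparr>).
      s = \<phi> (dihedral_gen m S) \<and> t = \<phi> (dihedral_gen m T))"

section \<open>Degree 2 extensions\<close>

definition degree_2_extension :: "'a monoid \<Rightarrow> 'a set \<Rightarrow> bool" where
  "degree_2_extension E D \<longleftrightarrow> group E \<and> subgroup D E \<and> card (rcosets\<^bsub>E\<^esub> D) = 2"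

definition centralizer :: "'a monoid \<Rightarrow> 'a set \<Rightarrow> 'a set" where
  "centralizer G A = {x \<in> carrier G. \<forall>a\<in>A. x \<otimes>\<^bsub>G\<^esub> a = a \<otimes>\<^bsub>G\<^esub> x}"

definition conj_by :: "'a monoid \<Rightarrow> 'a \<Rightarrow> 'a \<Rightarrow> 'a" where
  "conj_by G x e = inv\<^bsub>G\<^esub> e \<otimes>\<^bsub>G\<^esub> x \<otimes>\<^bsub>G\<^esub> e"

definition internal_direct_product :: "'a monoid \<Rightarrow> 'a set \<Rightarrow> 'a set \<Rightarrow> bool" where
  "internal_direct_product G A B \<longleftrightarrow> subgroup A G \<and> subgroup B G \<and>
    (\<lambda>(a, b). a \<otimes>\<^bsub>G\<^esub> b) \<in> iso (G\<lparr>carrier := A\<rparr> \<times>\<times> G\<lparr>carrier := B\<rparr>) G"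

definition internal_semidirect_product :: "'a monoid \<Rightarrow> 'a set \<Rightarrow> 'a set \<Rightarrow> bool" where
  "internal_semidirect_product G N B \<longleftrightarrow> N \<lhd> G \<and> subgroup B G \<and>
    N <#>\<^bsub>G\<^esub> B = carrier G \<and> N \<inter> B = {\<one>\<^bsub>G\<^esub>}"

text \<open>The index 2 subgroup \<open>D\<close> is required to be isomorphic to \<open>D_(2^d)\<close>.
  An extension is recorded as the pair of the big group and its subgroup of index 2, but, an
  extension being a group, isomorphism of extensions is isomorphism of the big groups. All these
  groups are finite, so any infinite carrier type \<open>'a\<close> contains a copy of each of them.\<close>

definition dihedral_extensions :: "nat \<Rightarrow> ('a monoid \<times> 'a set) set" where
  "dihedral_extensions d =
    {(E, D). degree_2_extension E D \<and> E\<lparr>carrier := D\<rparr> \<cong> dihedral_group d}"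

definition extension_iso :: "nat \<Rightarrow> (('a monoid \<times> 'a set) \<times> ('a monoid \<times> 'a set)) set" where
  "extension_iso d =
    {(P, Q). P \<in> dihedral_extensions d \<and> Q \<in> dihedral_extensions d \<and> fst P \<cong> fst Q}"

definition extension_classes :: "nat \<Rightarrow> ('a monoid \<times> 'a set) set set" where
  "extension_classes d = dihedral_extensions d // extension_iso d"

definition type_a :: "nat \<Rightarrow> ('a monoid \<times> 'a set) set" where
  "type_a d = {(E, D) \<in> dihedral_extensions d.
    \<exists>e \<in> centralizer E D.
      e [^]\<^bsub>E\<^esub> (2::nat) = \<one>\<^bsub>E\<^esub> \<and> internal_direct_product E D (generate E {e})}"

definition type_b :: "nat \<Rightarrow> ('a monoid \<times> 'a set) set" where
  "type_b d = {(E, D) \<in> dihedral_extensions d.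
    \<exists>s t. dihedral_gens d E D s t \<and>
      (\<exists>e \<in> centralizer E D.
        carrier E = D <#>\<^bsub>E\<^esub> generate E {e} \<and>
        e [^]\<^bsub>E\<^esub> (2::nat) = s [^]\<^bsub>E\<^esub> ((2::nat) ^ (d - 2)))}"

definition type_c :: "nat \<Rightarrow> ('a monoid \<times> 'a set) set" where
  "type_c d = {(E, D) \<in> dihedral_extensions d. E \<cong> dihedral_group (d + 1)}"

definition type_d :: "nat \<Rightarrow> ('a monoid \<times> 'a set) set" where
  "type_d d = {(E, D) \<in> dihedral_extensions d. E \<cong> semidihedral_group (d + 1)}"

text \<open>The generators \<open>s, t\<close> have to be chosen along with \<open>e\<close>: replacing \<open>t\<close> by \<open>st\<close> in a fixed
  extension of this kind destroys the existence of a suitable involution \<open>e\<close>.\<close>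

definition type_e :: "nat \<Rightarrow> ('a monoid \<times> 'a set) set" where
  "type_e d = {(E, D) \<in> dihedral_extensions d.
    \<exists>s t. dihedral_gens d E D s t \<and>
      (\<exists>e \<in> carrier E.
        internal_semidirect_product E D (generate E {e}) \<and>
        e [^]\<^bsub>E\<^esub> (2::nat) = \<one>\<^bsub>E\<^esub> \<and>
        conj_by E s e = s [^]\<^bsub>E\<^esub> ((2::nat) ^ (d - 2)) \<otimes>\<^bsub>E\<^esub> s \<and>
        conj_by E t e = t)}"

end

(*
  An extension E of D of degree two is determined by the action of an element e outside D on the
  rotation s and a reflection t, e s e^-1 = s^i and e t e^-1 = s^j t, together with e^2 = s^k.
  Here e^2 must be a rotation, since e^2 = s^k t would give i^2 = -1 modulo 4. Hence i^2 = 1 modulo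
  |s| = 4q, and replacing e by te gives i = 1 or i = 1 + 2q; replacing e by s^m e makes j equal
  to 0 or 1. The relation j(i + 1) = 2k leaves the triples (i, j, k)

    (1, 0, 0), (1, 0, 2q), (1, 1, 1), (1, 1, 1 + 2q), (1 + 2q, 0, 0),

  which are the types (a), (b), (c), (d), (e); for i = 1 + 2q and k = 2q one also replaces e by
  s^q e and t by st. When q = 1, that is d = 3, the last type does not arise because 1 + 2q = -1
  modulo 4. Each triple is realized by a cyclic extension of D, and it determines the group because
  it determines the products of the elements s^a t^b e^c. The groups are told apart by whether all
  x satisfy x^(4q) = 1, by whether an element of order 8q is conjugate to its inverse, and by the
  order and exponent of the center.
*)
theory Submission
  imports Defs
begin

section \<open>Presented groups\<close>

text \<open>With \<open>|s| = 4 * q\<close> and \<open>q = 2 ^ (d - 3)\<close>, the half turn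
  \<open>s_1\<close> is \<open>s ^ (2q)\<close> and all conditions are congruences modulo
  \<open>4q\<close>. They have one source: \<open>e^2 = s^k\<close> must act as conjugation by
  \<open>s^k\<close>. Applied to \<open>s\<close>, \<open>t\<close> and \<open>e\<close> this gives
  \<open>i^2 = 1\<close>, \<open>j(i + 1) = 2k\<close> and \<open>ik = k\<close>, and the same three
  congruences are what the cyclic extension needs in order to exist. The second value
  \<open>1 + 2q\<close> of \<open>i\<close> comes from \<open>i^2 = 1\<close>, which fixes
  \<open>i\<close> up to sign only modulo \<open>2q\<close>. Two obstacles shape the development.
  The dihedral and semidihedral groups are given by presentations, so that \<open>s\<close> has the
  full order \<open>4q\<close> and \<open>t\<close> is not a rotation has to be proved, by a
  homomorphism to an explicit model. And isomorphism of extensions ignores \<open>D\<close>, while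
  (c) and (d) say nothing of how \<open>D\<close> lies in \<open>E\<close>; hence the invariants
  speak of \<open>E\<close> alone, and identifying (c) and (d) with triples needs the uniqueness of
  the triple. Exponents are kept as integers, not residues, so that products are given by formulas
  without reduction.\<close>

lemma pres_cong_append_left: "pres_cong R u v \<Longrightarrow> pres_cong R (w @ u) (w @ v)"
proof (induction rule: pres_cong.induct)
  case (cancel u g b v)
  show ?case using pres_cong.cancel[of R "w @ u" g b v] by simp
next
  case (relator x u v)
  then show ?case using pres_cong.relator[of x R "w @ u" v] by simp
qed (auto intro: pres_cong.intros)

lemma pres_cong_append_right: "pres_cong R u v \<Longrightarrow> pres_cong R (u @ w) (v @ w)"
proof (induction rule: pres_cong.induct)
  case (cancel u g b v)
  show ?case using pres_cong.cancel[of R u g b "v @ w"] by simp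
next
  case (relator x u v)
  then show ?case using pres_cong.relator[of x R u "v @ w"] by simp
qed (auto intro: pres_cong.intros)

lemma pres_cong_append:
  "pres_cong R u u' \<Longrightarrow> pres_cong R v v' \<Longrightarrow> pres_cong R (u @ v) (u' @ v')"
  by (meson pres_cong.trans pres_cong_append_left pres_cong_append_right)

lemma word_class_eq_iff: "word_class R u = word_class R v \<longleftrightarrow> pres_cong R u v"
  unfolding word_class_def set_eq_iff mem_Collect_eq
  by (meson pres_cong.refl pres_cong.sym pres_cong.trans)

text \<open>The product is a union over all pairs of representatives. By congruence each pair
  contributes the same class, and the union runs over nonempty sets.\<close>

lemma mult_word_class:
  "word_class R u \<otimes>\<^bsub>presented_group R\<^esub> word_class R v = word_class R (u @ v)"
proof -
  have "word_class R (a @ b) = word_class R (u @ v)"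
    if "a \<in> word_class R u" "b \<in> word_class R v" for a b
  proof -
    have "pres_cong R (u @ v) (a @ b)"
      using that by (intro pres_cong_append) (simp_all add: word_class_def)
    then show ?thesis
      unfolding word_class_eq_iff by (rule pres_cong.sym)
  qed
  then have "(\<Union>a\<in>word_class R u. \<Union>b\<in>word_class R v. word_class R (a @ b)) =
      (\<Union>a\<in>word_class R u. \<Union>b\<in>word_class R v. word_class R (u @ v))"
    by (intro SUP_cong) simp_all
  moreover have "word_class R w \<noteq> {}" for w
    using pres_cong.refl[of R w] by (auto simp: word_class_def)
  ultimately show ?thesis
    unfolding presented_group_def by simp
qed

lemma carrier_presented_group: "carrier (presented_group R) = range (word_class R)"
  and one_presented_group: "\<one>\<^bsub>presented_group R\<^esub> = word_class R []"
  by (simp_all add: presented_group_def)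

definition word_inv :: "'g word \<Rightarrow> 'g word" where
  "word_inv w = rev (map (\<lambda>(g, b). (g, \<not> b)) w)"

lemma pres_cong_word_inv: "pres_cong R (word_inv w @ w) []"
proof (induction w)
  case Nil
  show ?case by (simp add: word_inv_def pres_cong.refl)
next
  case (Cons x w)
  obtain g b where x: "x = (g, b)" by fastforce
  have "pres_cong R (word_inv w @ [(g, \<not> b), (g, \<not> \<not> b)] @ w) (word_inv w @ w)"
    by (rule pres_cong.cancel)
  with Cons show ?case
    by (auto simp: x word_inv_def intro: pres_cong.trans)
qed

lemma group_presented_group: "group (presented_group R)"
proof (rule groupI)
  fix x assume "x \<in> carrier (presented_group R)"
  then obtain w where x: "x = word_class R w"
    by (auto simp: carrier_presented_group)
  have "word_class R (word_inv w) \<otimes>\<^bsub>presented_group R\<^esub> x = \<one>\<^bsub>presented_group R\<^esub>"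
    by (simp add: x mult_word_class one_presented_group word_class_eq_iff pres_cong_word_inv)
  then show "\<exists>y\<in>carrier (presented_group R). y \<otimes>\<^bsub>presented_group R\<^esub> x = \<one>\<^bsub>presented_group R\<^esub>"
    by (auto simp: carrier_presented_group)
qed (auto simp: carrier_presented_group mult_word_class one_presented_group)

lemma word_class_relator: "w \<in> R \<Longrightarrow> word_class R w = \<one>\<^bsub>presented_group R\<^esub>"
  using pres_cong.relator[of w R "[]" "[]"] by (simp add: one_presented_group word_class_eq_iff)

lemma word_class_inverse_letter:
  "word_class R [(g, False)] = inv\<^bsub>presented_group R\<^esub> word_class R [(g, True)]"
proof -
  have "word_class R [(g, False)] \<otimes>\<^bsub>presented_group R\<^esub> word_class R [(g, True)]
      = \<one>\<^bsub>presented_group R\<^esub>"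
    using pres_cong.cancel[of R "[]" g False "[]"]
    by (simp add: mult_word_class one_presented_group word_class_eq_iff)
  then show ?thesis
    using group.inv_equality[OF group_presented_group]
    by (metis carrier_presented_group rangeI)
qed

lemma word_class_word_pow:
  "word_class R (word_pow w n) = word_class R w [^]\<^bsub>presented_group R\<^esub> n"
proof -
  interpret group "presented_group R" by (rule group_presented_group)
  have w: "word_class R w \<in> carrier (presented_group R)"
    by (simp add: carrier_presented_group)
  show ?thesis
  proof (induction n)
    case (Suc n)
    have "word_class R (word_pow w (Suc n))
        = word_class R w \<otimes>\<^bsub>presented_group R\<^esub> word_class R (word_pow w n)"
      by (simp add: mult_word_class word_pow_def)
    then show ?case unfolding Suc nat_pow_Suc2[OF w] .
  qed (simp add: word_pow_def one_presented_group)
qed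

lemma presented_group_generated:
  assumes H: "subgroup H (presented_group R)"
    and gens: "\<And>g. word_class R [(g, True)] \<in> H"
  shows "H = carrier (presented_group R)"
proof -
  have "word_class R w \<in> H" for w
  proof (induction w)
    case Nil
    show ?case using subgroup.one_closed[OF H] by (simp add: one_presented_group)
  next
    case (Cons x w)
    obtain g b where x: "x = (g, b)" by fastforce
    have "word_class R [(g, b)] \<in> H"
      using gens[of g] subgroup.m_inv_closed[OF H]
      by (cases b) (auto simp: word_class_inverse_letter)
    then show ?case
      using subgroup.m_closed[OF H _ Cons, of "word_class R [x]"] by (simp add: mult_word_class x)
  qed
  then show ?thesis
    using subgroup.subset[OF H] by (auto simp: carrier_presented_group)
qed

primrec word_eval :: "('b, 'm) monoid_scheme \<Rightarrow> ('g \<Rightarrow> 'b) \<Rightarrow> 'g word \<Rightarrow> 'b" where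
  "word_eval G f [] = \<one>\<^bsub>G\<^esub>"
| "word_eval G f (x # w) =
    (if snd x then f (fst x) else inv\<^bsub>G\<^esub> f (fst x)) \<otimes>\<^bsub>G\<^esub> word_eval G f w"

context group
begin

lemma word_eval_closed: "(\<And>g. f g \<in> carrier G) \<Longrightarrow> word_eval G f w \<in> carrier G"
  by (induction w) auto

lemma word_eval_append:
  "(\<And>g. f g \<in> carrier G) \<Longrightarrow> word_eval G f (u @ v) = word_eval G f u \<otimes> word_eval G f v"
  by (induction u) (auto simp: word_eval_closed m_assoc)

lemma word_eval_word_pow:
  assumes "\<And>g. f g \<in> carrier G"
  shows "word_eval G f (word_pow w n) = word_eval G f w [^] n"
proof (induction n)
  case (Suc n)
  have "word_eval G f (word_pow w (Suc n)) = word_eval G f w \<otimes> word_eval G f (word_pow w n)"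
    by (simp add: word_pow_def word_eval_append assms)
  then show ?case unfolding Suc nat_pow_Suc2[OF word_eval_closed[OF assms]] .
qed (simp add: word_pow_def)

lemma word_eval_pres_cong:
  assumes f: "\<And>g. f g \<in> carrier G" and R: "\<And>w. w \<in> R \<Longrightarrow> word_eval G f w = \<one>"
  shows "pres_cong R u v \<Longrightarrow> word_eval G f u = word_eval G f v"
proof (induction rule: pres_cong.induct)
  case (cancel u g b v)
  then show ?case
    by (cases b) (simp_all add: word_eval_append f word_eval_closed flip: m_assoc[of "f g"] m_assoc[of "inv f g"])
qed (simp_all add: word_eval_append f word_eval_closed R)

text \<open>Von Dyck's theorem: evaluation of words is constant on congruence classes once the
  relators evaluate to \<open>\<one>\<close>, so any chosen representative gives the value.\<close>

lemma presented_group_hom: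
  assumes f: "\<And>g. f g \<in> carrier G" and R: "\<And>w. w \<in> R \<Longrightarrow> word_eval G f w = \<one>"
  obtains \<phi> where "\<phi> \<in> hom (presented_group R) G" "\<And>g. \<phi> (word_class R [(g, True)]) = f g"
proof
  define \<phi> where "\<phi> A = word_eval G f (SOME w. w \<in> A)" for A
  have \<phi>: "\<phi> (word_class R w) = word_eval G f w" for w
  proof -
    have "(SOME v. v \<in> word_class R w) \<in> word_class R w"
      by (rule someI[of _ w]) (simp add: word_class_def pres_cong.refl)
    then have "pres_cong R w (SOME v. v \<in> word_class R w)"
      unfolding word_class_def by blast
    from word_eval_pres_cong[OF f R this] show ?thesis
      unfolding \<phi>_def by simp
  qed
  show "\<phi> \<in> hom (presented_group R) G"
    by (rule homI)
      (auto simp: carrier_presented_group mult_word_class \<phi> word_eval_append f word_eval_closed)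
  show "\<phi> (word_class R [(g, True)]) = f g" for g
    by (simp add: \<phi> f)
qed

end

text \<open>The coordinates may be redundant, such as exponents modulo the order of an element.
  Hence injectivity is replaced by \<open>eq\<close>: both parametrizations identify the same
  coordinates. One multiplication rule \<open>m\<close> for both then makes the induced bijection a
  homomorphism.\<close>

lemma iso_by_coordinates:
  fixes f :: "'x \<Rightarrow> 'a" and f' :: "'x \<Rightarrow> 'b"
  assumes surj: "range f = carrier G" "range f' = carrier H"
    and mult: "\<And>x y. f (m x y) = f x \<otimes>\<^bsub>G\<^esub> f y" "\<And>x y. f' (m x y) = f' x \<otimes>\<^bsub>H\<^esub> f' y"
    and eq: "\<And>x y. f x = f y \<longleftrightarrow> f' x = f' y"
  obtains \<phi> where "\<phi> \<in> iso G H" "\<And>x. \<phi> (f x) = f' x"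
proof
  define \<phi> where "\<phi> z = f' (SOME x. f x = z)" for z
  show \<phi>: "\<phi> (f x) = f' x" for x
    unfolding \<phi>_def by (metis (mono_tags, lifting) someI eq)
  have "\<phi> \<in> hom G H"
    by (rule homI) (auto simp: \<phi> simp flip: surj mult)
  moreover have "bij_betw \<phi> (carrier G) (carrier H)"
    unfolding bij_betw_def inj_on_def
    using surj \<phi> eq by (auto simp flip: surj(1) simp: image_image)
  ultimately show "\<phi> \<in> iso G H" by (simp add: iso_def)
qed

section \<open>Cyclic extensions of degree two\<close>

text \<open>The pair \<open>(x, b)\<close> stands for \<open>x\<close> times the \<open>b\<close>-th power of an element \<open>e\<close> with
  \<open>e y e\<^sup>-\<^sup>1 = \<sigma> y\<close> and \<open>e\<^sup>2 = c\<close>.\<close>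

definition cyclic_extension :: "'a monoid \<Rightarrow> ('a \<Rightarrow> 'a) \<Rightarrow> 'a \<Rightarrow> ('a \<times> bool) monoid" where
  "cyclic_extension G \<sigma> c =
    \<lparr>carrier = carrier G \<times> UNIV,
     monoid.mult = (\<lambda>(x, b) (y, b').
       (x \<otimes>\<^bsub>G\<^esub> (if b then \<sigma> y else y) \<otimes>\<^bsub>G\<^esub> (if b \<and> b' then c else \<one>\<^bsub>G\<^esub>), b \<noteq> b')),
     one = (\<one>\<^bsub>G\<^esub>, False)\<rparr>"

lemma carrier_cyclic_extension: "carrier (cyclic_extension G \<sigma> c) = carrier G \<times> UNIV"
  and one_cyclic_extension: "\<one>\<^bsub>cyclic_extension G \<sigma> c\<^esub> = (\<one>\<^bsub>G\<^esub>, False)"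
  and mult_cyclic_extension: "(x, b) \<otimes>\<^bsub>cyclic_extension G \<sigma> c\<^esub> (y, b') =
    (x \<otimes>\<^bsub>G\<^esub> (if b then \<sigma> y else y) \<otimes>\<^bsub>G\<^esub> (if b \<and> b' then c else \<one>\<^bsub>G\<^esub>), b \<noteq> b')"
  by (simp_all add: cyclic_extension_def)

lemmas cyclic_extension_simps =
  carrier_cyclic_extension one_cyclic_extension mult_cyclic_extension

text \<open>The classical compatibility conditions: \<open>e\<close> commutes with its own square
  \<open>c\<close>, and \<open>\<sigma>\<close> applied twice is conjugation by \<open>c\<close>.
  The second is written without inverses.\<close>

lemma group_cyclic_extension:
  fixes G (structure)
  assumes "group G" and \<sigma>: "\<sigma> \<in> hom G G" and c: "c \<in> carrier G" and \<sigma>c: "\<sigma> c = c"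
    and \<sigma>\<sigma>: "\<And>x. x \<in> carrier G \<Longrightarrow> \<sigma> (\<sigma> x) \<otimes>\<^bsub>G\<^esub> c = c \<otimes>\<^bsub>G\<^esub> x"
  shows "group (cyclic_extension G \<sigma> c)"
proof -
  interpret group G by fact
  note [simp] = c \<sigma>c hom_in_carrier[OF \<sigma>] hom_mult[OF \<sigma>] hom_one[OF \<sigma> \<open>group G\<close> \<open>group G\<close>]
  have \<sigma>\<sigma>': "\<sigma> (\<sigma> x) \<otimes> (c \<otimes> y) = c \<otimes> (x \<otimes> y)" if "x \<in> carrier G" "y \<in> carrier G" for x y
    using \<sigma>\<sigma>[OF that(1)] that by (simp flip: m_assoc)
  show ?thesis
  proof (rule groupI)
    fix x assume "x \<in> carrier (cyclic_extension G \<sigma> c)"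
    then obtain y b where x: "x = (y, b)" and y: "y \<in> carrier G"
      by (auto simp: carrier_cyclic_extension)
    show "\<exists>z\<in>carrier (cyclic_extension G \<sigma> c).
        z \<otimes>\<^bsub>cyclic_extension G \<sigma> c\<^esub> x = \<one>\<^bsub>cyclic_extension G \<sigma> c\<^esub>"
    proof (cases b)
      case True
      have "inv c \<otimes> inv \<sigma> y \<otimes> \<sigma> y \<otimes> c = \<one>"
        using y by (simp add: m_assoc)
      with y True show ?thesis
        \<comment> \<open>With \<open>e\<close> for \<open>(\<one>, True)\<close>, the left inverse
          of \<open>y e\<close> is \<open>inv c \<otimes> inv \<sigma> y\<close> times
          \<open>e\<close>: moving \<open>e\<close> past \<open>y\<close> produces
          \<open>\<sigma> y\<close>, and the two letters \<open>e\<close> leave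
          \<open>c\<close>.\<close>
        by (intro bexI[of _ "(inv c \<otimes> inv \<sigma> y, True)"]) (auto simp: x cyclic_extension_simps)
    next
      case False
      with y show ?thesis
        by (intro bexI[of _ "(inv y, False)"]) (auto simp: x cyclic_extension_simps)
    qed
  next
    fix x y z
    assume "x \<in> carrier (cyclic_extension G \<sigma> c)" "y \<in> carrier (cyclic_extension G \<sigma> c)"
      "z \<in> carrier (cyclic_extension G \<sigma> c)"
    then show "x \<otimes>\<^bsub>cyclic_extension G \<sigma> c\<^esub> y \<otimes>\<^bsub>cyclic_extension G \<sigma> c\<^esub> z =
        x \<otimes>\<^bsub>cyclic_extension G \<sigma> c\<^esub> (y \<otimes>\<^bsub>cyclic_extension G \<sigma> c\<^esub> z)"
      by (cases x; cases y; cases z; cases "snd x"; cases "snd y"; cases "snd z")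
        (simp_all add: cyclic_extension_simps m_assoc \<sigma>\<sigma> \<sigma>\<sigma>')
  qed (auto simp: cyclic_extension_simps)
qed

lemma cyclic_extension_embedding:
  "group G \<Longrightarrow> (\<lambda>x. (x, False)) \<in> hom G (cyclic_extension G \<sigma> c)"
  by (auto simp: hom_def cyclic_extension_simps group.is_monoid monoid.m_closed monoid.r_one)

lemma int_pow_cyclic_extension:
  fixes a :: int
  assumes "group G" "group (cyclic_extension G \<sigma> c)" "x \<in> carrier G"
  shows "(x, False) [^]\<^bsub>cyclic_extension G \<sigma> c\<^esub> a = (x [^]\<^bsub>G\<^esub> a, False)"
  using hom_int_pow[OF cyclic_extension_embedding[OF assms(1)] assms(3,1,2)] by simp

section \<open>Metacyclic groups with an involution acting on a cyclic normal subgroup\<close>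

text \<open>No order is imposed on \<open>t\<close>, because the lemma serves both the reflection
  \<open>t\<close> and the outer element \<open>e\<close>, each of which maps \<open>s\<close> to a
  power of itself.\<close>

lemma (in group) int_pow_conjugate:
  fixes a r :: int
  assumes [simp]: "s \<in> carrier G" "t \<in> carrier G" and t_s: "t \<otimes> s = s [^] r \<otimes> t"
  shows "t \<otimes> s [^] a = s [^] (r * a) \<otimes> t"
proof -
  have nat: "t \<otimes> s [^] (int n) = s [^] (r * int n) \<otimes> t" for n
  proof (induction n)
    case (Suc n)
    have "t \<otimes> s [^] int (Suc n) = t \<otimes> s \<otimes> s [^] int n"
      by (simp add: int_pow_mult m_assoc)
    also have "\<dots> = s [^] r \<otimes> (t \<otimes> s [^] int n)"
      by (simp add: t_s m_assoc)
    also have "\<dots> = s [^] r \<otimes> s [^] (r * int n) \<otimes> t"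
      by (simp add: Suc m_assoc)
    also have "\<dots> = s [^] (r * int (Suc n)) \<otimes> t"
      by (simp add: distrib_left flip: int_pow_mult)
    finally show ?case .
  qed simp
  show ?thesis
  proof (cases "a \<ge> 0")
    case True
    with nat[of "nat a"] show ?thesis by simp
  next
    case False
    then obtain n where a: "a = - int n"
      by (metis int_cases linear of_nat_0_le_iff)
    \<comment> \<open>For a negative exponent, both sides are multiplied by
      \<open>s ^ (r n)\<close>, which reduces the claim to the nonnegative case.\<close>
    have "s [^] (r * int n) \<otimes> (t \<otimes> s [^] a) = t \<otimes> s [^] int n \<otimes> s [^] a"
      by (simp add: nat m_assoc)
    also have "\<dots> = t"
      by (simp add: m_assoc a flip: int_pow_mult)
    also have "\<dots> = s [^] (r * int n) \<otimes> (s [^] (r * a) \<otimes> t)"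
      by (simp add: a flip: m_assoc int_pow_mult)
    finally show ?thesis by simp
  qed
qed

text \<open>Three layers. The relations alone allow computation, also in a presented group whose
  order is not yet known. \<open>metacyclic_subgroup\<close> adds that nothing collapses, which
  describes \<open>D\<close> inside a larger group. \<open>metacyclic\<close> adds that the whole
  group is reached.\<close>

locale metacyclic_relations = group G for G (structure) +
  fixes s t :: 'a and N r :: int
  assumes s_closed [simp]: "s \<in> carrier G" and t_closed [simp]: "t \<in> carrier G"
    and s_pow_N: "s [^] N = \<one>" and t_t: "t \<otimes> t = \<one>" and t_s: "t \<otimes> s = s [^] r \<otimes> t"
begin

lemma t_s_pow: "t \<otimes> s [^] (a::int) = s [^] (r * a) \<otimes> t"
  by (rule int_pow_conjugate) (simp_all add: t_s)

lemma t_s_pow': "x \<in> carrier G \<Longrightarrow> t \<otimes> (s [^] (a::int) \<otimes> x) = s [^] (r * a) \<otimes> (t \<otimes> x)"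
  by (simp add: t_s_pow flip: m_assoc)

lemma t_t': "x \<in> carrier G \<Longrightarrow> t \<otimes> (t \<otimes> x) = x"
  by (simp add: t_t flip: m_assoc)

lemma s_pow_add: "s [^] (a::int) \<otimes> s [^] (b::int) = s [^] (a + b)"
  by (simp add: int_pow_mult)

lemma s_pow_add': "x \<in> carrier G \<Longrightarrow> s [^] (a::int) \<otimes> (s [^] (b::int) \<otimes> x) = s [^] (a + b) \<otimes> x"
  by (simp add: int_pow_mult m_assoc)

lemmas normalize = m_assoc s_pow_add s_pow_add' t_s_pow t_s_pow' t_t t_t'

definition elt :: "int \<times> bool \<Rightarrow> 'a" where
  "elt = (\<lambda>(a, b). s [^] a \<otimes> (if b then t else \<one>))"

lemma elt_closed: "elt x \<in> carrier G"
  by (auto simp: elt_def split: prod.split)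

lemma elt_mult:
  "elt x \<otimes> elt y = elt (fst x + (if snd x then r * fst y else fst y), snd x \<noteq> snd y)"
  by (cases x; cases y) (auto simp: elt_def normalize)

lemma s_pow_mult_N: "N dvd a \<Longrightarrow> s [^] a = \<one>"
  using int_pow_pow[OF s_closed, of N] by (auto simp: s_pow_N elim!: dvdE)

lemma s_pow_cong: "N dvd a - b \<Longrightarrow> s [^] a = s [^] b"
  using s_pow_mult_N[of "a - b"] s_pow_add[of "a - b" b] by simp

lemma subgroup_range_elt: "subgroup (range elt) G"
proof (rule subgroupI)
  show "range elt \<subseteq> carrier G" by (auto simp: elt_closed)
  fix x assume "x \<in> range elt"
  then obtain a b where x: "x = elt (a, b)" by auto
  \<comment> \<open>The inverse of \<open>s^a t\<close> is \<open>t s^(-a)\<close>, which is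
    \<open>s^(-r a) t\<close>.\<close>
  have "inv x = elt (if b then - (r * a) else - a, b)"
    by (rule inv_equality)
      (auto simp: elt_mult x elt_closed, simp_all add: elt_def)
  then show "inv x \<in> range elt" by simp
qed (auto simp: elt_mult)

end

locale metacyclic_subgroup = metacyclic_relations +
  assumes s_pow_eq_one_D: "s [^] (a::int) = \<one> \<Longrightarrow> N dvd a"
    and t_not_s_pow: "t \<noteq> s [^] (a::int)"
begin

lemma s_pow_eq_iff: "s [^] a = s [^] b \<longleftrightarrow> N dvd a - b" for a b :: int
proof
  assume "s [^] a = s [^] b"
  then have "s [^] (a - b) = \<one>" by (simp add: int_pow_diff)
  then show "N dvd a - b" by (rule s_pow_eq_one_D)
qed (rule s_pow_cong)

lemma s_pow_t_not_s_pow: "s [^] a \<otimes> t \<noteq> s [^] b" for a b :: int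
proof
  assume "s [^] a \<otimes> t = s [^] b"
  then have "s [^] (- a) \<otimes> (s [^] a \<otimes> t) = s [^] (b - a)"
    by (simp add: s_pow_add)
  then have "t = s [^] (b - a)" by (simp add: s_pow_add')
  with t_not_s_pow show False by blast
qed

lemma elt_eq_iff: "elt x = elt y \<longleftrightarrow> N dvd fst x - fst y \<and> snd x = snd y"
  by (cases x; cases y)
    (auto simp: elt_def s_pow_eq_iff s_pow_t_not_s_pow s_pow_t_not_s_pow[symmetric])

lemma s_pow_eq_one_iff: "s [^] a = \<one> \<longleftrightarrow> N dvd a" for a :: int
  using s_pow_eq_one_D s_pow_mult_N by blast

end

locale metacyclic = metacyclic_subgroup +
  assumes carrier_eq: "carrier G = range elt"

text \<open>The product of two coordinates involves only \<open>r\<close>, and their equality only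
  \<open>N\<close>. The images of the generators are recorded because automorphisms are obtained
  from this lemma too, by taking a second generating pair of one group.\<close>

lemma metacyclic_iso:
  assumes "metacyclic G s t N r" "metacyclic H s' t' N r"
  obtains \<phi> where "\<phi> \<in> iso G H" "\<phi> s = s'" "\<phi> t = t'"
proof -
  interpret G: metacyclic G s t N r by fact
  interpret H: metacyclic H s' t' N r by fact
  have eq: "G.elt x = G.elt y \<longleftrightarrow> H.elt x = H.elt y" for x y
    by (simp add: G.elt_eq_iff H.elt_eq_iff)
  obtain \<phi> where \<phi>: "\<phi> \<in> iso G H" "\<And>x. \<phi> (G.elt x) = H.elt x"
    by (rule iso_by_coordinates[where f = G.elt and f' = H.elt and G = G and H = H and
          m = "\<lambda>x y. (fst x + (if snd x then r * fst y else fst y), snd x \<noteq> snd y)"])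
      (auto simp only: G.carrier_eq H.carrier_eq G.elt_mult H.elt_mult eq)
  show thesis
    using \<phi>(2)[of "(1, False)"] \<phi>(2)[of "(0, True)"]
    by (intro that[of \<phi>]) (simp_all add: \<phi>(1) G.elt_def H.elt_def)
qed

lemma metacyclic_subgroup_image:
  assumes "metacyclic_subgroup G s t N r" "group H" "\<phi> \<in> iso G H"
  shows "metacyclic_subgroup H (\<phi> s) (\<phi> t) N r"
    and "metacyclic_relations.elt H (\<phi> s) (\<phi> t) x = \<phi> (metacyclic_relations.elt G s t x)"
proof -
  interpret G: metacyclic_subgroup G s t N r by fact
  interpret H: group H by fact
  have hom: "\<phi> \<in> hom G H" and inj: "inj_on \<phi> (carrier G)"
    using assms(3) by (auto simp: iso_def bij_betw_def)
  have pow: "\<phi> s [^]\<^bsub>H\<^esub> a = \<phi> (s [^]\<^bsub>G\<^esub> a)" for a :: int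
    using hom_int_pow[OF hom] assms(2) by simp
  have one: "\<phi> x = \<one>\<^bsub>H\<^esub> \<longleftrightarrow> x = \<one>\<^bsub>G\<^esub>" if "x \<in> carrier G" for x
    using that inj hom_one[OF hom] assms(2) by (metis G.is_group G.one_closed inj_onD)
  interpret H: metacyclic_relations H "\<phi> s" "\<phi> t" N r
    by unfold_locales
      (simp_all add: hom_in_carrier[OF hom] pow one G.s_pow_N G.t_t G.t_s flip: hom_mult[OF hom])
  show "H.elt x = \<phi> (G.elt x)"
    by (cases x) (simp add: H.elt_def G.elt_def pow hom_mult[OF hom] hom_in_carrier[OF hom]
        hom_one[OF hom G.is_group H.is_group])
  show "metacyclic_subgroup H (\<phi> s) (\<phi> t) N r"
  proof
    show "N dvd a" if "\<phi> s [^]\<^bsub>H\<^esub> a = \<one>\<^bsub>H\<^esub>" for a :: int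
      using that by (simp add: pow one G.s_pow_eq_one_iff)
    show "\<phi> t \<noteq> \<phi> s [^]\<^bsub>H\<^esub> a" for a :: int
      using G.t_not_s_pow[of a] inj_onD[OF inj, of t "s [^]\<^bsub>G\<^esub> a"] by (auto simp: pow)
  qed
qed

lemma metacyclic_image:
  assumes "metacyclic G s t N r" "group H" "\<phi> \<in> iso G H"
  shows "metacyclic H (\<phi> s) (\<phi> t) N r"
proof -
  interpret G: metacyclic G s t N r by fact
  note image = metacyclic_subgroup_image[OF G.metacyclic_subgroup_axioms assms(2,3)]
  interpret H: metacyclic_subgroup H "\<phi> s" "\<phi> t" N r by (rule image)
  have "carrier H = \<phi> ` carrier G"
    using assms(3) by (auto simp: iso_def bij_betw_def)
  also have "\<dots> = range H.elt"
    by (simp add: G.carrier_eq image image_image)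
  finally show ?thesis
    by unfold_locales
qed

text \<open>Powers and products in \<open>D\<close> are those of \<open>E\<close>. This moves the
  abstract description of \<open>D\<close> into the ambient group, where \<open>e\<close> is also
  available.\<close>

lemma metacyclic_of_subgroup_iff:
  assumes "group E" "subgroup D E"
  shows "metacyclic (E\<lparr>carrier := D\<rparr>) s t N r \<longleftrightarrow>
    metacyclic_subgroup E s t N r \<and> D = range (metacyclic_relations.elt E s t)"
proof -
  interpret E: group E by fact
  interpret D: subgroup D E by fact
  let ?D = "E\<lparr>carrier := D\<rparr>"
  interpret D: group ?D by (rule E.subgroup_imp_group) fact
  have pow: "s [^]\<^bsub>?D\<^esub> a = s [^]\<^bsub>E\<^esub> a" if "s \<in> D" for a :: int
    using E.int_pow_consistent[OF assms(2) that] by simp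
  have relations: "metacyclic_relations ?D s t N r \<longleftrightarrow> metacyclic_relations E s t N r \<and> s \<in> D \<and> t \<in> D"
  proof (cases "s \<in> D \<and> t \<in> D")
    case True
    then show ?thesis
      using D.subset
      by (simp add: metacyclic_relations_def metacyclic_relations_axioms_def pow E.is_group
          D.is_group subset_iff)
  qed (auto simp: metacyclic_relations_def metacyclic_relations_axioms_def)
  have elt: "metacyclic_relations.elt ?D s t = metacyclic_relations.elt E s t"
    if "metacyclic_relations ?D s t N r"
  proof -
    from that relations have "metacyclic_relations E s t N r" "s \<in> D" by simp_all
    with that pow show ?thesis
      by (simp add: metacyclic_relations.elt_def fun_eq_iff)
  qed
  have gens: "s \<in> D" "t \<in> D"
    if "metacyclic_relations E s t N r" "D = range (metacyclic_relations.elt E s t)"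
  proof -
    interpret metacyclic_relations E s t N r by fact
    have "elt (1, False) = s" "elt (0, True) = t"
      by (simp_all add: elt_def)
    then show "s \<in> D" "t \<in> D"
      unfolding that(2) by (metis rangeI)+
  qed
  show ?thesis
    using relations elt gens pow
    by (auto simp: metacyclic_def metacyclic_axioms_def metacyclic_subgroup_def
        metacyclic_subgroup_axioms_def)
qed

text \<open>The model is the cyclic group of order \<open>N\<close> extended by multiplication by
  \<open>r\<close>, with \<open>t^2 = 1\<close>. The congruence on \<open>r\<close> says that
  multiplying twice by \<open>r\<close> is the identity.\<close>

lemma metacyclic_exists:
  assumes N: "0 < N" and r: "N dvd r * r - 1"
  obtains G :: "(int \<times> bool) monoid" and s t where "metacyclic G s t N r"
proof -
  define Z where "Z = integer_mod_group (nat N)"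
  have Z: "carrier Z = {0..<N}" "\<one>\<^bsub>Z\<^esub> = 0" "\<And>x y. x \<otimes>\<^bsub>Z\<^esub> y = (x + y) mod N"
    "\<And>x a. x [^]\<^bsub>Z\<^esub> a = (a * x) mod N" for a :: int
    using N unfolding Z_def by (auto simp: carrier_integer_mod_group int_pow_integer_mod_group)
  have gZ: "group Z" by (simp add: Z_def)
  define \<sigma> where "\<sigma> x = r * x mod N" for x
  have \<sigma>\<sigma>: "\<sigma> (\<sigma> x) = x" if "x \<in> carrier Z" for x
  proof -
    have "\<sigma> (\<sigma> x) = (r * r) * x mod N"
      by (simp add: \<sigma>_def mod_mult_right_eq mult.assoc)
    also have "\<dots> = 1 * x mod N"
      using r by (metis mod_eq_dvd_iff mod_mult_left_eq)
    finally show ?thesis using that by (simp add: Z)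
  qed
  define G where "G = cyclic_extension Z \<sigma> 0"
  have gG: "group G"
    unfolding G_def
  proof (rule group_cyclic_extension[OF gZ])
    show "\<sigma> \<in> hom Z Z"
      using N by (auto simp: hom_def Z \<sigma>_def mod_simps distrib_left)
    show "\<sigma> (\<sigma> x) \<otimes>\<^bsub>Z\<^esub> 0 = 0 \<otimes>\<^bsub>Z\<^esub> x" if "x \<in> carrier Z" for x
      using \<sigma>\<sigma>[OF that] by (simp add: Z)
  qed (use N in \<open>auto simp: Z \<sigma>_def\<close>)
  \<comment> \<open>The reduction matters for \<open>N = 1\<close>, where the carrier is
    \<open>{0}\<close>.\<close>
  define s where "s = (1 mod N, False)"
  define t where "t = (0 :: int, True)"
  have pow: "s [^]\<^bsub>G\<^esub> a = (a mod N, False)" for a :: int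
    unfolding G_def s_def using N gG
    by (subst int_pow_cyclic_extension[OF gZ]) (auto simp: Z G_def mod_simps)
  have one: "\<one>\<^bsub>G\<^esub> = (0, False)"
    by (simp add: G_def cyclic_extension_simps Z)
  interpret metacyclic_relations G s t N r
    by (rule metacyclic_relations.intro[OF gG], unfold_locales)
      (use N in \<open>auto simp: pow\<close>,
        auto simp: G_def s_def t_def cyclic_extension_simps Z \<sigma>_def mod_simps)
  have "metacyclic G s t N r"
  proof
    show "N dvd a" if "s [^]\<^bsub>G\<^esub> a = \<one>\<^bsub>G\<^esub>" for a :: int
      using that by (auto simp: pow one)
    show "t \<noteq> s [^]\<^bsub>G\<^esub> a" for a :: int
      by (simp add: pow t_def)
    have "x \<in> range elt" if "x \<in> carrier G" for x
    proof -
      obtain a b where x: "x = (a, b)" "a \<in> {0..<N}"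
        using \<open>x \<in> carrier G\<close> by (auto simp: G_def cyclic_extension_simps Z)
      then have "x = elt (a, b)"
        by (auto simp: elt_def pow) (auto simp: G_def t_def cyclic_extension_simps Z)
      then show ?thesis by simp
    qed
    then show "carrier G = range elt"
      using elt_closed by blast
  qed
  then show thesis by (rule that)
qed

text \<open>The relations bound the presented group from above: every element is some
  \<open>s^a t^b\<close>. The homomorphism to the explicit model bounds it from below, since a
  coincidence among these elements would persist in the model. Hypothesis \<open>univ\<close> is
  needed only on the type of that model.\<close>

lemma metacyclic_presented_group:
  fixes R :: "gen word set"
  defines "s \<equiv> word_class R [(S, True)]" and "t \<equiv> word_class R [(T, True)]"
  assumes N: "0 < N" "N dvd r * r - 1"
    and rel: "metacyclic_relations (presented_group R) s t N r"
    and univ: "\<And>(G :: (int \<times> bool) monoid) s t w. metacyclic_relations G s t N r \<Longrightarrow> w \<in> R \<Longrightarrow>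
      word_eval G (case_gen s t) w = \<one>\<^bsub>G\<^esub>"
  shows "metacyclic (presented_group R) s t N r"
proof -
  interpret metacyclic_relations "presented_group R" s t N r by fact
  obtain G :: "(int \<times> bool) monoid" and s' t' where "metacyclic G s' t' N r"
    using metacyclic_exists[OF N] .
  then interpret G: metacyclic G s' t' N r .
  have "case_gen s' t' g \<in> carrier G" for g by (cases g) auto
  then obtain \<phi> where \<phi>: "\<phi> \<in> hom (presented_group R) G"
    "\<And>g. \<phi> (word_class R [(g, True)]) = case_gen s' t' g"
    using G.presented_group_hom[OF _ univ[OF G.metacyclic_relations_axioms]] by blast
  have st: "\<phi> s = s'" "\<phi> t = t'"
    using \<phi>(2) by (simp_all add: s_def t_def)
  have pow: "\<phi> (s [^]\<^bsub>presented_group R\<^esub> a) = s' [^]\<^bsub>G\<^esub> a" for a :: int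
    using hom_int_pow[OF \<phi>(1) s_closed is_group G.is_group] st by simp
  show ?thesis
  proof
    show "N dvd a" if "s [^]\<^bsub>presented_group R\<^esub> a = \<one>\<^bsub>presented_group R\<^esub>" for a :: int
      using pow[of a] that hom_one[OF \<phi>(1) is_group G.is_group] G.s_pow_eq_one_D by simp
    show "t \<noteq> s [^]\<^bsub>presented_group R\<^esub> a" for a :: int
      using pow[of a] st G.t_not_s_pow by auto
    have "word_class R [(g, True)] \<in> range elt" for g
    proof (cases g)
      case S
      have "elt (1, False) = s" by (simp add: elt_def)
      then show ?thesis unfolding S s_def by (metis rangeI)
    next
      case T
      have "elt (0, True) = t" by (simp add: elt_def)
      then show ?thesis unfolding T t_def by (metis rangeI)
    qed
    then show "carrier (presented_group R) = range elt"
      using presented_group_generated[OF subgroup_range_elt] by blast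
  qed
qed

section \<open>Dihedral and semidihedral groups as metacyclic groups\<close>

text \<open>Turns a semidihedral relator, which says that
  \<open>inv t \<otimes> s \<otimes> t\<close> equals \<open>x\<close>, into the rewriting form of
  the locale; \<open>t\<close> is its own inverse.\<close>

lemma (in group) mult_eq_of_conjugate:
  assumes "t \<in> carrier G" "s \<in> carrier G" "x \<in> carrier G" "t \<otimes> t = \<one>" "inv t \<otimes> s \<otimes> t \<otimes> inv x = \<one>"
  shows "t \<otimes> s = x \<otimes> t"
proof -
  have "inv t = t" using assms by (simp add: inv_equality)
  with assms have "t \<otimes> s \<otimes> t = x"
    by (metis inv_comm inv_equality inv_inv m_closed inv_closed)
  moreover have "t \<otimes> s = t \<otimes> s \<otimes> t \<otimes> t"
    using assms by (simp add: m_assoc)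
  ultimately show ?thesis by simp
qed

lemma metacyclic_dihedral_group:
  "metacyclic (dihedral_group m) (dihedral_gen m S) (dihedral_gen m T) (2 ^ (m - 1)) (- 1)"
  unfolding dihedral_group_def dihedral_gen_def
proof (rule metacyclic_presented_group)
  let ?R = "dihedral_relators m"
  let ?G = "presented_group ?R"
  interpret group ?G by (rule group_presented_group)
  define s t where "s = word_class ?R [(S, True)]" and "t = word_class ?R [(T, True)]"
  have c: "s \<in> carrier ?G" "t \<in> carrier ?G"
    by (simp_all add: s_def t_def carrier_presented_group)
  have s: "s [^]\<^bsub>?G\<^esub> (2 ^ (m - 1) :: nat) = \<one>\<^bsub>?G\<^esub>"
    unfolding s_def word_class_word_pow[symmetric]
    by (rule word_class_relator) (simp add: dihedral_relators_def)
  have "t [^]\<^bsub>?G\<^esub> (2 :: nat) = \<one>\<^bsub>?G\<^esub>"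
    unfolding t_def word_class_word_pow[symmetric]
    by (rule word_class_relator) (simp add: dihedral_relators_def)
  then have t: "t \<otimes>\<^bsub>?G\<^esub> t = \<one>\<^bsub>?G\<^esub>"
    using c by (simp add: numeral_2_eq_2)
  have "word_class ?R [(S, True), (T, True)] [^]\<^bsub>?G\<^esub> (2 :: nat) = \<one>\<^bsub>?G\<^esub>"
    unfolding word_class_word_pow[symmetric]
    by (rule word_class_relator) (simp add: dihedral_relators_def)
  moreover have "word_class ?R [(S, True), (T, True)] = s \<otimes>\<^bsub>?G\<^esub> t"
    by (simp add: s_def t_def mult_word_class)
  \<comment> \<open>Regrouped, \<open>(st)^2 = 1\<close> says that \<open>t s t\<close> is the
    inverse of \<open>s\<close>, so \<open>r = - 1\<close>.\<close>
  ultimately have "s \<otimes>\<^bsub>?G\<^esub> (t \<otimes>\<^bsub>?G\<^esub> s \<otimes>\<^bsub>?G\<^esub> t) = \<one>\<^bsub>?G\<^esub>"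
    using c by (simp add: numeral_2_eq_2 m_assoc)
  then have "t \<otimes>\<^bsub>?G\<^esub> s \<otimes>\<^bsub>?G\<^esub> t = inv\<^bsub>?G\<^esub> s"
    using c by (metis inv_equality inv_comm m_closed)
  then have "t \<otimes>\<^bsub>?G\<^esub> s \<otimes>\<^bsub>?G\<^esub> (t \<otimes>\<^bsub>?G\<^esub> t) = inv\<^bsub>?G\<^esub> s \<otimes>\<^bsub>?G\<^esub> t"
    using c by (simp flip: m_assoc)
  then have ts: "t \<otimes>\<^bsub>?G\<^esub> s = inv\<^bsub>?G\<^esub> s \<otimes>\<^bsub>?G\<^esub> t"
    using c t by simp
  show "metacyclic_relations ?G s t (2 ^ (m - 1)) (- 1)"
    using c s t ts int_pow_int[of ?G s "2 ^ (m - 1)"] by unfold_locales (simp_all add: int_pow_neg)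
next
  fix G :: "(int \<times> bool) monoid" and s t w
  assume "metacyclic_relations G s t (2 ^ (m - 1)) (- 1)" and w: "w \<in> dihedral_relators m"
  then interpret metacyclic_relations G s t "2 ^ (m - 1)" "- 1" by simp
  have f: "case_gen s t g \<in> carrier G" for g by (cases g) auto
  have N: "s [^]\<^bsub>G\<^esub> (2 ^ (m - 1) :: nat) = \<one>\<^bsub>G\<^esub>"
    using s_pow_N int_pow_int[of G s "2 ^ (m - 1)"] by simp
  have "t \<otimes>\<^bsub>G\<^esub> (s \<otimes>\<^bsub>G\<^esub> t) = inv\<^bsub>G\<^esub> s"
    using t_s by (simp add: int_pow_neg t_t m_assoc flip: m_assoc[of t s t])
  then show "word_eval G (case_gen s t) w = \<one>\<^bsub>G\<^esub>"
    using w N by (auto simp: dihedral_relators_def word_eval_word_pow[OF f] numeral_2_eq_2 t_t m_assoc)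
qed simp_all

lemma metacyclic_semidihedral_group:
  assumes "3 \<le> m"
  obtains s t where "metacyclic (semidihedral_group m) s t (2 ^ (m - 1)) (2 ^ (m - 2) - 1)"
proof -
  define R where "R = {word_pow [(S, True)] (2 ^ (m - 1)), word_pow [(T, True)] 2,
     [(T, False), (S, True), (T, True)] @ word_pow [(S, False)] (2 ^ (m - 2) - 1)}"
  define r :: nat where "r = 2 ^ (m - 2) - 1"
  have r: "int r = 2 ^ (m - 2) - 1" by (simp add: r_def of_nat_diff)
  have "metacyclic (presented_group R) (word_class R [(S, True)]) (word_class R [(T, True)])
      (2 ^ (m - 1)) (int r)"
  proof (rule metacyclic_presented_group)
    \<comment> \<open>The bound on \<open>m\<close> makes all exponents honest:
      \<open>(2^(m-2) - 1)^2 - 1 = 2^(m-1) (2^(m-3) - 1)\<close>.\<close>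
    obtain n where m: "m = n + 3" using assms by (metis le_Suc_ex add.commute)
    have "int r * int r - 1 = 2 ^ (m - 1) * (2 ^ n - 1)"
      unfolding r by (simp add: m algebra_simps flip: power_add)
    then show "2 ^ (m - 1) dvd int r * int r - 1" by simp
  next
    let ?G = "presented_group R"
    interpret group ?G by (rule group_presented_group)
    define s t where "s = word_class R [(S, True)]" and "t = word_class R [(T, True)]"
    have c: "s \<in> carrier ?G" "t \<in> carrier ?G"
      by (simp_all add: s_def t_def carrier_presented_group)
    have s: "s [^]\<^bsub>?G\<^esub> (2 ^ (m - 1) :: nat) = \<one>\<^bsub>?G\<^esub>"
      unfolding s_def word_class_word_pow[symmetric]
      by (rule word_class_relator) (simp add: R_def)
    have "t [^]\<^bsub>?G\<^esub> (2 :: nat) = \<one>\<^bsub>?G\<^esub>"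
      unfolding t_def word_class_word_pow[symmetric]
      by (rule word_class_relator) (simp add: R_def)
    then have t: "t \<otimes>\<^bsub>?G\<^esub> t = \<one>\<^bsub>?G\<^esub>"
      using c by (simp add: numeral_2_eq_2)
    have "word_class R ([(T, False)] @ [(S, True)] @ [(T, True)] @ word_pow [(S, False)] r) = \<one>\<^bsub>?G\<^esub>"
      by (rule word_class_relator) (simp add: R_def r_def)
    then have "inv\<^bsub>?G\<^esub> t \<otimes>\<^bsub>?G\<^esub> s \<otimes>\<^bsub>?G\<^esub> t \<otimes>\<^bsub>?G\<^esub> inv\<^bsub>?G\<^esub> (s [^]\<^bsub>?G\<^esub> r) = \<one>\<^bsub>?G\<^esub>"
      using c unfolding mult_word_class[symmetric] word_class_word_pow word_class_inverse_letter
      by (simp add: m_assoc nat_pow_inv flip: s_def t_def)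
    then have ts: "t \<otimes>\<^bsub>?G\<^esub> s = s [^]\<^bsub>?G\<^esub> r \<otimes>\<^bsub>?G\<^esub> t"
      using c t by (intro mult_eq_of_conjugate) auto
    show "metacyclic_relations ?G s t (2 ^ (m - 1)) (int r)"
      using c s t ts int_pow_int[of ?G s "2 ^ (m - 1)"]
      by unfold_locales (simp_all add: int_pow_int)
  next
    fix G :: "(int \<times> bool) monoid" and s t w
    assume "metacyclic_relations G s t (2 ^ (m - 1)) (int r)" and w: "w \<in> R"
    then interpret metacyclic_relations G s t "2 ^ (m - 1)" "int r" by simp
    have f: "case_gen s t g \<in> carrier G" for g by (cases g) auto
    have N: "s [^]\<^bsub>G\<^esub> (2 ^ (m - 1) :: nat) = \<one>\<^bsub>G\<^esub>"
      using s_pow_N int_pow_int[of G s "2 ^ (m - 1)"] by simp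
    have t2: "t [^]\<^bsub>G\<^esub> (2 :: nat) = \<one>\<^bsub>G\<^esub>"
      by (simp add: numeral_2_eq_2 t_t)
    have inv: "inv\<^bsub>G\<^esub> t = t" by (simp add: inv_equality t_t)
    have "t \<otimes>\<^bsub>G\<^esub> (s \<otimes>\<^bsub>G\<^esub> (t \<otimes>\<^bsub>G\<^esub> inv\<^bsub>G\<^esub> (s [^]\<^bsub>G\<^esub> r))) =
        (t \<otimes>\<^bsub>G\<^esub> s) \<otimes>\<^bsub>G\<^esub> t \<otimes>\<^bsub>G\<^esub> inv\<^bsub>G\<^esub> (s [^]\<^bsub>G\<^esub> r)"
      by (simp add: m_assoc)
    also have "\<dots> = \<one>\<^bsub>G\<^esub>"
      by (simp add: t_s int_pow_int m_assoc t_t')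
    finally show "word_eval G (case_gen s t) w = \<one>\<^bsub>G\<^esub>"
      using w N t2 by (auto simp: R_def word_eval_append[OF f] word_eval_word_pow[OF f]
          m_assoc inv nat_pow_inv simp flip: r_def[unfolded One_nat_def])
  qed simp
  then show thesis
    using that by (simp add: r semidihedral_group_def R_def)
qed

section \<open>Extensions of degree two of a dihedral group\<close>

text \<open>Here \<open>D\<close> is \<open>range elt\<close>, and \<open>q\<close> is any positive
  integer; only the reduction to normal form needs a power of two. Writing the order of
  \<open>s\<close> as \<open>4 * q\<close> names the half turn \<open>s^(2q)\<close> and the quarter
  turn \<open>s^q\<close> without division.\<close>

locale dihedral_extension = metacyclic_subgroup E s t "4 * q" "- 1"
  for E :: "'a monoid" (structure) and s t :: 'a and q :: int +
  fixes e :: 'a and i j k :: int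
  assumes q_pos: "0 < q"
    and e_closed [simp]: "e \<in> carrier E" and e_notin: "e \<notin> range elt"
    and carrier_E: "carrier E = range elt \<union> (range elt #> e)"
    and e_s: "e \<otimes> s = s [^] i \<otimes> e" and e_t: "e \<otimes> t = s [^] j \<otimes> t \<otimes> e"
    and e_e: "e \<otimes> e = s [^] k"
begin

lemma e_s_pow: "e \<otimes> s [^] a = s [^] (i * a) \<otimes> e" for a :: int
  by (rule int_pow_conjugate) (simp_all add: e_s)

lemma e_s_pow': "x \<in> carrier E \<Longrightarrow> e \<otimes> (s [^] a \<otimes> x) = s [^] (i * a) \<otimes> (e \<otimes> x)" for a :: int
  by (simp add: e_s_pow flip: m_assoc)

lemma e_t': "x \<in> carrier E \<Longrightarrow> e \<otimes> (t \<otimes> x) = s [^] j \<otimes> (t \<otimes> (e \<otimes> x))"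
  using e_t by (simp flip: m_assoc)

lemma e_e': "x \<in> carrier E \<Longrightarrow> e \<otimes> (e \<otimes> x) = s [^] k \<otimes> x"
  by (simp add: e_e flip: m_assoc)

lemma e_t_assoc: "e \<otimes> t = s [^] j \<otimes> (t \<otimes> e)"
  by (simp add: e_t m_assoc)

lemmas normalize_ext = normalize e_s_pow e_s_pow' e_t_assoc e_t' e_e e_e'

definition ext_elt :: "(int \<times> bool) \<times> bool \<Rightarrow> 'a" where
  "ext_elt = (\<lambda>(x, c). elt x \<otimes> (if c then e else \<one>))"

lemma ext_elt_closed: "ext_elt x \<in> carrier E"
  by (auto simp: ext_elt_def elt_closed split: prod.split)

lemma carrier_ext: "carrier E = range ext_elt"
proof -
  have "ext_elt (x, False) = elt x" "ext_elt (x, True) = elt x \<otimes> e" for x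
    by (simp_all add: ext_elt_def elt_closed)
  moreover have "range ext_elt = range (\<lambda>x. ext_elt (x, False)) \<union> range (\<lambda>x. ext_elt (x, True))"
    by (simp add: set_eq_iff image_iff split_paired_Ex ex_bool_eq ex_disj_distrib disj_ac)
  ultimately show ?thesis
    by (simp add: carrier_E r_coset_def UNION_singleton_eq_range image_image)
qed

lemma elt_mult_e_neq: "elt x \<otimes> e \<noteq> elt y"
proof
  assume "elt x \<otimes> e = elt y"
  then have "e = inv (elt x) \<otimes> elt y"
    by (simp add: elt_closed inv_solve_left)
  then have "e \<in> range elt"
    using subgroup_range_elt by (simp add: subgroup.m_closed subgroup.m_inv_closed)
  with e_notin show False ..
qed

lemma ext_elt_eq_iff:
  "ext_elt ((a, b), c) = ext_elt ((a', b'), c') \<longleftrightarrow> 4 * q dvd a - a' \<and> b = b' \<and> c = c'"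
proof -
  have "ext_elt ((a, b), c) = ext_elt ((a', b'), c') \<longleftrightarrow> c = c' \<and> elt (a, b) = elt (a', b')"
    by (cases c; cases c')
      (simp_all add: ext_elt_def elt_closed elt_mult_e_neq elt_mult_e_neq[symmetric])
  then show ?thesis by (auto simp: elt_eq_iff)
qed

text \<open>A reflection on the left negates the exponent that passes it, and \<open>e\<close>
  passing \<open>t\<close> contributes \<open>j\<close>. If both factors contain \<open>e\<close>,
  then \<open>e^2 = s^k\<close> is moved left past the product of the reflections, which negates
  \<open>k\<close> exactly when one reflection remains.\<close>

lemma ext_elt_mult:
  "ext_elt ((a, b), c) \<otimes> ext_elt ((a', b'), c') =
    ext_elt ((a + (if b then - 1 else 1) * ((if c then i * a' else a') + (if c \<and> b' then j else 0))
      + (if c \<and> c' then if b \<noteq> b' then - k else k else 0), b \<noteq> b'), c \<noteq> c')"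
  by (cases b; cases c; cases b'; cases c')
    (auto simp: ext_elt_def elt_def normalize_ext algebra_simps)

lemma one_ext_elt: "\<one> = ext_elt ((0, False), False)"
  and s_ext_elt: "s = ext_elt ((1, False), False)"
  and t_ext_elt: "t = ext_elt ((0, True), False)"
  and e_ext_elt: "e = ext_elt ((0, False), True)"
  by (simp_all add: ext_elt_def elt_def)

lemmas ext_elt_mult_gens =
  ext_elt_mult[where a = 1 and b = False and c = False, folded s_ext_elt]
  ext_elt_mult[where a = 0 and b = True and c = False, folded t_ext_elt]
  ext_elt_mult[where a = 0 and b = False and c = True, folded e_ext_elt]
  ext_elt_mult[where a' = 1 and b' = False and c' = False, folded s_ext_elt]
  ext_elt_mult[where a' = 0 and b' = True and c' = False, folded t_ext_elt]
  ext_elt_mult[where a' = 0 and b' = False and c' = True, folded e_ext_elt]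

end

lemma dihedral_extension_iso:
  assumes "dihedral_extension E s t q e i j k" "dihedral_extension E' s' t' q e' i j k"
  shows "E \<cong> E'"
proof -
  interpret E: dihedral_extension E s t q e i j k by fact
  interpret E': dihedral_extension E' s' t' q e' i j k by fact
  obtain \<phi> where "\<phi> \<in> iso E E'"
    by (rule iso_by_coordinates[where f = E.ext_elt and f' = E'.ext_elt and G = E and H = E' and
        m = "\<lambda>((a, b), c) ((a', b'), c').
          ((a + (if b then - 1 else 1) * ((if c then i * a' else a') + (if c \<and> b' then j else 0))
            + (if c \<and> c' then if b \<noteq> b' then - k else k else 0), b \<noteq> b'), c \<noteq> c')"])
      (simp_all only: E.carrier_ext E'.carrier_ext E.ext_elt_mult E'.ext_elt_mult
        E.ext_elt_eq_iff E'.ext_elt_eq_iff split_paired_all prod.case diff_self dvd_0_right simp_thms)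
  then show ?thesis by (rule is_isoI)
qed

lemma dihedral_extension_image:
  assumes "dihedral_extension E s t q e i j k" "group H" "\<phi> \<in> iso E H"
  shows "dihedral_extension H (\<phi> s) (\<phi> t) q (\<phi> e) i j k"
    and "range (metacyclic_relations.elt H (\<phi> s) (\<phi> t)) = \<phi> ` range (metacyclic_relations.elt E s t)"
proof -
  interpret E: dihedral_extension E s t q e i j k by fact
  note image = metacyclic_subgroup_image[OF E.metacyclic_subgroup_axioms assms(2,3)]
  interpret H: metacyclic_subgroup H "\<phi> s" "\<phi> t" "4 * q" "- 1" by (rule image)
  have hom: "\<phi> \<in> hom E H" and inj: "inj_on \<phi> (carrier E)" and im: "\<phi> ` carrier E = carrier H"
    using assms(3) by (auto simp: iso_def bij_betw_def)
  have pow: "\<phi> s [^]\<^bsub>H\<^esub> a = \<phi> (s [^]\<^bsub>E\<^esub> a)" for a :: int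
    using hom_int_pow[OF hom] assms(2) by simp
  show range: "range H.elt = \<phi> ` range E.elt"
    by (simp add: image image_image)
  show "dihedral_extension H (\<phi> s) (\<phi> t) q (\<phi> e) i j k"
  proof unfold_locales
    show "\<phi> e \<notin> range H.elt"
      unfolding range inj_on_image_mem_iff[OF inj E.e_closed subgroup.subset[OF E.subgroup_range_elt]]
      by (rule E.e_notin)
    have "\<phi> ` (range E.elt #>\<^bsub>E\<^esub> e) = range H.elt #>\<^bsub>H\<^esub> \<phi> e"
      by (simp add: range r_coset_def image_UN hom_mult[OF hom E.elt_closed E.e_closed])
    then show "carrier H = range H.elt \<union> (range H.elt #>\<^bsub>H\<^esub> \<phi> e)"
      by (simp add: E.carrier_E image_Un range flip: im)
  qed (simp_all add: hom_in_carrier[OF hom] E.q_pos pow E.e_s E.e_t E.e_e flip: hom_mult[OF hom])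
qed

section \<open>Changes of the complement and the reflection, and relations between the
  parameters\<close>

context dihedral_extension
begin

lemma change_parameters:
  assumes "4 * q dvd i - i'" "4 * q dvd j - j'" "4 * q dvd k - k'"
  shows "dihedral_extension E s t q e i' j' k'"
  using s_pow_cong[OF assms(1)] s_pow_cong[OF assms(2)] s_pow_cong[OF assms(3)]
  by unfold_locales (simp_all add: q_pos e_notin e_s e_t e_e, simp add: carrier_E)

lemma change_complement:
  assumes e': "e' = elt x \<otimes> e"
    and "e' \<otimes> s = s [^] i' \<otimes> e'" "e' \<otimes> t = s [^] j' \<otimes> t \<otimes> e'" "e' \<otimes> e' = s [^] k'"
  shows "dihedral_extension E s t q e' i' j' k'"
proof unfold_locales
  have "range elt #> e' = (range elt #> elt x) #> e"
    unfolding e' by (rule coset_mult_assoc[symmetric])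
      (use subgroup.subset[OF subgroup_range_elt] in \<open>simp_all add: elt_closed\<close>)
  also have "range elt #> elt x = range elt"
    by (rule coset_join2[OF elt_closed subgroup_range_elt rangeI])
  finally show "carrier E = range elt \<union> (range elt #> e')"
    by (simp add: carrier_E)
  show "e' \<notin> range elt"
    unfolding e' by (metis elt_mult_e_neq rangeE)
  show "e' \<in> carrier E" by (simp add: e' elt_closed)
qed (use assms(2-) q_pos in simp_all)

text \<open>Conjugation by \<open>t\<close> negates \<open>i\<close> and \<open>j\<close>, and
  \<open>(te)^2 = t (s^j t e) e = s^(k - j)\<close>. This is the move that corrects the sign of
  \<open>i\<close>.\<close>

lemma change_complement_t: "dihedral_extension E s t q (t \<otimes> e) (- i) (- j) (k - j)"
  by (rule change_complement[where x = "(0, True)"])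
    (simp_all add: elt_def normalize_ext e_s)

text \<open>Conjugation by \<open>s^m\<close> fixes rotations and shifts reflections by
  \<open>2m\<close>, so \<open>j\<close> matters only modulo 2; the square becomes
  \<open>s^m s^(i m) s^k\<close>.\<close>

lemma change_complement_s:
  "dihedral_extension E s t q (s [^] m \<otimes> e) i (j + 2 * m) (k + m * (1 + i))" for m :: int
  by (rule change_complement[where x = "(m, False)"])
    (simp_all add: elt_def normalize_ext e_s algebra_simps)

text \<open>Since \<open>e\<close> maps \<open>st\<close> to \<open>s^(i + j) t\<close>, which is
  \<open>s^(i + j - 1)\<close> times \<open>st\<close>, the parameter \<open>j\<close> moves by
  \<open>i - 1\<close> while \<open>D\<close> stays the same. For \<open>i = 1 + 2q\<close> this
  shift by \<open>2q\<close> absorbs the half turn.\<close>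

lemma change_reflection:
  shows "dihedral_extension E s (s \<otimes> t) q e i (i + j - 1) k"
    and "range (metacyclic_relations.elt E s (s \<otimes> t)) = range elt"
proof -
  interpret st: metacyclic_subgroup E s "s \<otimes> t" "4 * q" "- 1"
  proof unfold_locales
    show "s \<otimes> t \<otimes> (s \<otimes> t) = \<one>"
      using elt_mult[of "(1, True)" "(1, True)"] by (simp add: elt_def)
    show "s \<otimes> t \<otimes> s = s [^] (- 1 :: int) \<otimes> (s \<otimes> t)"
      using elt_mult[of "(1, True)" "(1, False)"] elt_mult[of "(- 1, False)" "(1, True)"]
      by (simp add: elt_def)
    show "s \<otimes> t \<noteq> s [^] a" for a :: int
      using s_pow_t_not_s_pow[of 1 a] by simp
  qed (simp_all add: s_pow_eq_one_iff s_pow_N)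
  have elt: "st.elt (a, b) = elt (if b then a + 1 else a, b)" for a b
    using elt_mult[of "(a, False)" "(1, True)"] by (simp add: elt_def st.elt_def)
  have "elt (a, b) = st.elt (if b then a - 1 else a, b)" for a b
    by (simp add: elt)
  with elt show range: "range st.elt = range elt"
    by (intro subset_antisym image_subsetI) (metis rangeI surj_pair)+
  show "dihedral_extension E s (s \<otimes> t) q e i (i + j - 1) k"
  proof unfold_locales
    show "e \<otimes> (s \<otimes> t) = s [^] (i + j - 1) \<otimes> (s \<otimes> t) \<otimes> e"
      using ext_elt_mult[of 0 False True 1 True False] elt_mult[of "(i + j - 1, False)" "(1, True)"]
      by (simp add: ext_elt_def elt_def)
    show "carrier E = range st.elt \<union> (range st.elt #> e)"
      by (simp add: range carrier_E)
  qed (simp_all add: range q_pos e_notin e_s e_e)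
qed

text \<open>Each congruence compares conjugation by \<open>e\<close> done twice with conjugation by
  \<open>s^k\<close>, on \<open>s\<close>, on \<open>t\<close> and on \<open>e\<close> in
  turn.\<close>

lemma parameter_congruences:
  shows "4 * q dvd i * i - 1" and "4 * q dvd j * (i + 1) - 2 * k" and "4 * q dvd i * k - k"
proof -
  have "s [^] k \<otimes> s [^] (1 :: int) = e \<otimes> (e \<otimes> s [^] (1 :: int))"
    by (rule e_e'[symmetric]) simp
  also have "\<dots> = s [^] (i * i) \<otimes> s [^] k"
    by (simp add: e_s_pow e_s_pow' e_e del: int_pow_1)
  finally show "4 * q dvd i * i - 1"
    by (simp add: s_pow_add s_pow_eq_iff dvd_diff_commute del: int_pow_1)
  have "s [^] k \<otimes> t = e \<otimes> (e \<otimes> t)"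
    by (rule e_e'[symmetric]) simp
  also have "\<dots> = s [^] (i * j + j - k) \<otimes> t"
    by (simp add: normalize_ext algebra_simps)
  finally show "4 * q dvd j * (i + 1) - 2 * k"
    by (simp add: s_pow_eq_iff dvd_diff_commute algebra_simps)
  have "s [^] k \<otimes> e = e \<otimes> (e \<otimes> e)"
    by (rule e_e'[symmetric]) simp
  also have "\<dots> = s [^] (i * k) \<otimes> e"
    by (simp add: e_e e_s_pow)
  finally show "4 * q dvd i * k - k"
    by (simp add: s_pow_eq_iff dvd_diff_commute)
qed

end

section \<open>Isomorphism invariants\<close>

text \<open>The parity test removes the last triple for \<open>q = 1\<close>: there
  \<open>(3, 0, 0)\<close> turns into \<open>(1, 0, 0)\<close> when \<open>e\<close> is replaced by
  \<open>te\<close>.\<close>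

definition dihedral_parameters :: "int \<Rightarrow> (int \<times> int \<times> int) set" where
  "dihedral_parameters q =
    {(1, 0, 0), (1, 0, 2 * q), (1, 1, 1), (1, 1, 1 + 2 * q)} \<union>
    (if even q then {(1 + 2 * q, 0, 0)} else {})"

context dihedral_extension
begin

lemma ext_elt_eq_one_iff: "ext_elt ((a, b), c) = \<one> \<longleftrightarrow> 4 * q dvd a \<and> \<not> b \<and> \<not> c"
  by (simp add: one_ext_elt ext_elt_eq_iff)

lemma not_4q_dvd: "0 < x \<Longrightarrow> x < 4 * q \<Longrightarrow> \<not> 4 * q dvd x"
  by (auto dest: zdvd_imp_le)

text \<open>Every square is a rotation \<open>s^w\<close>, so the power \<open>4q\<close> is
  \<open>s^(2 q w)\<close>, trivial exactly for even \<open>w\<close>. Under the parity hypotheses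
  \<open>w\<close> is odd only for the elements \<open>s^a e\<close> with \<open>k\<close>
  odd.\<close>

lemma pow_eq_one_iff:
  assumes "odd i" "even (j + k)"
  shows "ext_elt ((a, b), c) [^] (4 * q) = \<one> \<longleftrightarrow> \<not> (c \<and> \<not> b \<and> odd k)"
proof -
  define x where "x = ext_elt ((a, b), c)"
  define w where "w = (if b then if c then a - (i * a + j) + k else 0
    else if c then a + i * a + k else 2 * a)"
  have x: "x \<in> carrier E" by (simp add: x_def ext_elt_closed)
  have "x [^] (2 :: int) = x \<otimes> x"
    using int_pow_mult[OF x, of 1 1] x by simp
  also have "\<dots> = ext_elt ((w, False), False)"
    by (simp add: x_def w_def ext_elt_mult algebra_simps)
  also have "\<dots> = s [^] w"
    by (simp add: ext_elt_def elt_def)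
  finally have "x [^] (4 * q) = s [^] (w * (2 * q))"
    using int_pow_pow[OF x, of 2 "2 * q"] int_pow_pow[OF s_closed, of w "2 * q"] by simp
  then have "x [^] (4 * q) = \<one> \<longleftrightarrow> 2 * (2 * q) dvd w * (2 * q)"
    by (simp add: s_pow_eq_one_iff)
  also have "\<dots> \<longleftrightarrow> even w"
    using q_pos by (subst dvd_mult_cancel_right) simp
  also have "\<dots> \<longleftrightarrow> \<not> (c \<and> \<not> b \<and> odd k)"
    using assms by (auto simp: w_def)
  finally show ?thesis by (simp add: x_def)
qed

lemma exponent_iff:
  assumes "(i, j, k) \<in> dihedral_parameters q"
  shows "(\<forall>x\<in>carrier E. x [^] (4 * q) = \<one>) \<longleftrightarrow> even k"
proof -
  have "odd i" "even (j + k)"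
    using assms by (auto simp: dihedral_parameters_def split: if_splits)
  then show ?thesis
    by (auto simp: carrier_ext pow_eq_one_iff)
qed

text \<open>The equation \<open>y u y = u\<close> says that \<open>u\<close> conjugates
  \<open>y\<close> to its inverse. The candidates \<open>y\<close> are the elements
  \<open>s^a e\<close>, which commute with \<open>s\<close> and \<open>e\<close>; so
  \<open>u\<close> must involve \<open>t\<close>, and then \<open>y t y = s^(1 - k) t\<close> forces
  \<open>k = 1\<close>. This separates dihedral from semidihedral.\<close>

lemma inverted_element_iff:
  assumes "(i, j, k) \<in> {(1, 1, 1), (1, 1, 1 + 2 * q)}"
  shows "(\<exists>y\<in>carrier E. \<exists>u\<in>carrier E. y [^] (4 * q) \<noteq> \<one> \<and> y \<otimes> u \<otimes> y = u) \<longleftrightarrow> k = 1"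
proof
  have ij: "i = 1" "j = 1" "odd k" using assms by auto
  {
    assume "k = 1"
    moreover have "e [^] (4 * q) \<noteq> \<one>"
      using ij pow_eq_one_iff[of 0 False True] by (simp flip: e_ext_elt)
    moreover have "e \<otimes> ext_elt ((0, True), False) \<otimes> e = ext_elt ((0, True), False)" if "k = 1"
      by (simp add: ext_elt_mult_gens ij that)
    ultimately show "\<exists>y\<in>carrier E. \<exists>u\<in>carrier E. y [^] (4 * q) \<noteq> \<one> \<and> y \<otimes> u \<otimes> y = u"
      using e_closed ext_elt_closed by blast
  }
  assume "\<exists>y\<in>carrier E. \<exists>u\<in>carrier E. y [^] (4 * q) \<noteq> \<one> \<and> y \<otimes> u \<otimes> y = u"
  then obtain a b c a' b' c' where pow: "ext_elt ((a, b), c) [^] (4 * q) \<noteq> \<one>"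
    and eq: "ext_elt ((a, b), c) \<otimes> ext_elt ((a', b'), c') \<otimes> ext_elt ((a, b), c) = ext_elt ((a', b'), c')"
    unfolding carrier_ext by fast
  have bc: "\<not> b" "c"
    using pow ij by (simp_all add: pow_eq_one_iff)
  have even: "even x" if "4 * q dvd x" for x
    using that by (meson dvd_mult2 dvd_trans even_numeral)
  show "k = 1"
  proof (cases b')
    case True
    have "4 * q dvd 1 - k"
      using eq by (auto simp: bc True ij ext_elt_mult ext_elt_eq_iff split: if_splits)
    then show ?thesis
      using assms not_4q_dvd[of "2 * q"] q_pos by auto
  next
    case False
    have "4 * q dvd 2 * a + k"
      using eq by (auto simp: bc False ij ext_elt_mult ext_elt_eq_iff algebra_simps split: if_splits)
    from even[OF this] show ?thesis
      using ij by simp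
  qed
qed

text \<open>Commuting with \<open>s\<close> excludes reflections, since neither 2 nor
  \<open>2 + 2q\<close> is divisible by \<open>4q\<close>, and excludes \<open>e\<close> unless
  \<open>i = 1\<close>. Commuting with \<open>t\<close> then forces \<open>2a = 0\<close> modulo
  \<open>4q\<close>. The bound \<open>1 < q\<close> is what gives
  \<open>2 + 2q < 4q\<close>.\<close>

lemma central_gens:
  assumes "ext_elt ((a, b), c) \<in> centralizer E (carrier E)"
    and ij: "i = 1 \<and> j = 0 \<or> i = 1 + 2 * q \<and> j = 0 \<and> 1 < q"
  shows "\<not> b" and "c \<Longrightarrow> i = 1" and "4 * q dvd 2 * a"
proof -
  have comm: "ext_elt ((a, b), c) \<otimes> x = x \<otimes> ext_elt ((a, b), c)" if "x \<in> carrier E" for x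
    using assms(1) that by (simp add: centralizer_def)
  have s: "4 * q dvd (if b then - 1 else 1) * (if c then i else 1) - 1"
    using comm[OF s_closed] by (simp add: ext_elt_mult_gens ext_elt_eq_iff split: if_splits)
  show b: "\<not> b"
  proof
    assume b
    with s ij have "4 * q dvd 2 \<or> 4 * q dvd 2 + 2 * q \<and> 1 < q"
      using dvd_minus_iff[of "4 * q" "2 + 2 * q"] by (cases c) (auto simp: algebra_simps)
    then show False
      using not_4q_dvd[of 2] not_4q_dvd[of "2 + 2 * q"] q_pos by auto
  qed
  show "i = 1" if c
    using s that b ij not_4q_dvd[of "2 * q"] q_pos by auto
  have "4 * q dvd 2 * a \<or> 4 * q dvd - (2 * a)"
    using comm[OF t_closed] b ij
    by (auto simp: ext_elt_mult_gens ext_elt_eq_iff split: if_splits)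
  then show "4 * q dvd 2 * a" by simp
qed

lemma e_central: "i = 1 \<Longrightarrow> j = 0 \<Longrightarrow> e \<in> centralizer E (carrier E)"
  using e_closed by (auto simp: centralizer_def carrier_ext ext_elt_mult_gens ext_elt_eq_iff)

lemma s_pow_2q_central:
  assumes "i = 1"
  shows "s [^] (2 * q) \<in> centralizer E (carrier E)"
proof -
  have "ext_elt ((2 * q, False), False) = s [^] (2 * q)"
    by (simp add: ext_elt_def elt_def)
  moreover have "ext_elt ((2 * q, False), False) \<in> centralizer E (carrier E)"
    using assms ext_elt_closed[of "((2 * q, False), False)"]
    by (auto simp: centralizer_def carrier_ext ext_elt_mult ext_elt_eq_iff)
  ultimately show ?thesis by simp
qed

text \<open>For \<open>k = 2q\<close> the central element \<open>e\<close> squares to the half turn.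
  For \<open>k = 0\<close> a central element is \<open>s^a\<close> or \<open>s^a e\<close> with
  \<open>4q\<close> dividing \<open>2a\<close>, so its square is trivial.\<close>

lemma central_square_iff:
  assumes "(i, j, k) \<in> dihedral_parameters q - {(1, 1, 1), (1, 1, 1 + 2 * q)}"
  shows "(\<exists>z\<in>centralizer E (carrier E). z \<otimes> z \<noteq> \<one>) \<longleftrightarrow> k \<noteq> 0"
proof
  have q: "1 < q" if "even q"
    using that q_pos by presburger
  have ij: "i = 1 \<and> j = 0 \<or> i = 1 + 2 * q \<and> j = 0 \<and> 1 < q"
    using assms q by (auto simp: dihedral_parameters_def split: if_splits)
  have k: "k = 0 \<or> i = 1 \<and> k = 2 * q"
    using assms by (auto simp: dihedral_parameters_def split: if_splits)
  {
    assume "k \<noteq> 0"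
    with k have "e \<otimes> e \<noteq> \<one>"
      using not_4q_dvd[of "2 * q"] q_pos by (simp add: e_e s_pow_eq_one_iff)
    with e_central k ij \<open>k \<noteq> 0\<close> q_pos show "\<exists>z\<in>centralizer E (carrier E). z \<otimes> z \<noteq> \<one>" by auto
  }
  assume "\<exists>z\<in>centralizer E (carrier E). z \<otimes> z \<noteq> \<one>"
  then obtain a b c where z: "ext_elt ((a, b), c) \<in> centralizer E (carrier E)"
    and "ext_elt ((a, b), c) \<otimes> ext_elt ((a, b), c) \<noteq> \<one>"
    unfolding centralizer_def carrier_ext by fast
  then show "k \<noteq> 0"
    using central_gens[OF z ij] by (auto simp: ext_elt_mult ext_elt_eq_one_iff)
qed

text \<open>Says that the center has more than two elements, without cardinalities. For
  \<open>i = 1\<close> it contains \<open>e\<close> and the half turn; otherwise it consists of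
  powers of the half turn.\<close>

lemma two_central_iff:
  assumes "(i, j, k) \<in> {(1, 0, 0), (1 + 2 * q, 0, 0)} \<inter> dihedral_parameters q"
  shows "(\<exists>z\<in>centralizer E (carrier E). \<exists>z'\<in>centralizer E (carrier E). z \<noteq> \<one> \<and> z' \<noteq> \<one> \<and> z \<noteq> z')
    \<longleftrightarrow> i = 1"
proof
  have q: "1 < q" if "even q"
    using that q_pos by presburger
  have ij: "i = 1 \<and> j = 0 \<or> i = 1 + 2 * q \<and> j = 0 \<and> 1 < q"
    using assms q by (auto simp: dihedral_parameters_def split: if_splits)
  {
    assume i: "i = 1"
    have "e \<noteq> s [^] a" for a :: int
      using ext_elt_eq_iff[of 0 False True a False False] by (simp add: ext_elt_def elt_def)
    moreover have "s [^] (2 * q) \<noteq> \<one>"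
      using not_4q_dvd[of "2 * q"] q_pos by (simp add: s_pow_eq_one_iff)
    ultimately show "\<exists>z\<in>centralizer E (carrier E). \<exists>z'\<in>centralizer E (carrier E).
        z \<noteq> \<one> \<and> z' \<noteq> \<one> \<and> z \<noteq> z'"
      using e_central s_pow_2q_central i ij by (metis int_pow_0 add_cancel_right_right less_irrefl mult_eq_0_iff)
  }
  assume "\<exists>z\<in>centralizer E (carrier E). \<exists>z'\<in>centralizer E (carrier E).
      z \<noteq> \<one> \<and> z' \<noteq> \<one> \<and> z \<noteq> z'"
  then obtain a b c a' b' c' where z: "ext_elt ((a, b), c) \<in> centralizer E (carrier E)"
    "ext_elt ((a', b'), c') \<in> centralizer E (carrier E)"
    and neq: "ext_elt ((a, b), c) \<noteq> \<one>" "ext_elt ((a', b'), c') \<noteq> \<one>"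
      "ext_elt ((a, b), c) \<noteq> ext_elt ((a', b'), c')"
    unfolding centralizer_def carrier_ext by fast
  show "i = 1"
  proof (rule ccontr)
    assume "i \<noteq> 1"
    then have "\<not> b" "\<not> c" "\<not> b'" "\<not> c'" "4 * q dvd 2 * a" "4 * q dvd 2 * a'"
      using central_gens[OF z(1) ij] central_gens[OF z(2) ij] by blast+
    with neq have ndvd: "\<not> 4 * q dvd a" "\<not> 4 * q dvd a'" "\<not> 4 * q dvd a - a'"
      by (simp_all add: ext_elt_eq_one_iff ext_elt_eq_iff)
    obtain m m' where "2 * a = 4 * q * m" "2 * a' = 4 * q * m'"
      using \<open>4 * q dvd 2 * a\<close> \<open>4 * q dvd 2 * a'\<close> by (elim dvdE) blast
    \<comment> \<open>Nontrivial central rotations are odd multiples of the half turn, and two odd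
      multiples differ by a multiple of \<open>4q\<close>.\<close>
    then have a: "a = 2 * q * m" "a' = 2 * q * m'" by simp_all
    have *: "4 * q dvd 2 * q * x" if "even x" for x
      using that by (auto elim!: evenE)
    have "odd m" "odd m'" using ndvd * unfolding a by blast+
    then have "4 * q dvd 2 * q * (m - m')" by (intro *) simp
    with ndvd show False by (simp add: a right_diff_distrib)
  qed
qed

end

text \<open>Both descriptions live in the same \<open>E\<close>, possibly with different dihedral
  subgroups, so each invariant can be equated directly. Isomorphic groups are reduced to this case
  by transport of the generators.\<close>

theorem dihedral_parameters_unique:
  assumes "dihedral_extension E s t q e i j k" "(i, j, k) \<in> dihedral_parameters q"
    and "dihedral_extension E s' t' q e' i' j' k'" "(i', j', k') \<in> dihedral_parameters q"
  shows "(i, j, k) = (i', j', k')"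
proof -
  interpret A: dihedral_extension E s t q e i j k by fact
  interpret B: dihedral_extension E s' t' q e' i' j' k' by fact
  have k: "even k \<longleftrightarrow> even k'"
    using A.exponent_iff[OF assms(2)] B.exponent_iff[OF assms(4)] by simp
  show ?thesis
  proof (cases "even k")
    case False
    with k assms(2,4) have *: "(i, j, k) \<in> {(1, 1, 1), (1, 1, 1 + 2 * q)}"
      "(i', j', k') \<in> {(1, 1, 1), (1, 1, 1 + 2 * q)}"
      by (auto simp: dihedral_parameters_def split: if_splits)
    with A.inverted_element_iff B.inverted_element_iff have "k = 1 \<longleftrightarrow> k' = 1" by simp
    with * show ?thesis by auto
  next
    case True
    with k have "(i, j, k) \<in> dihedral_parameters q - {(1, 1, 1), (1, 1, 1 + 2 * q)}"
      "(i', j', k') \<in> dihedral_parameters q - {(1, 1, 1), (1, 1, 1 + 2 * q)}"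
      using assms(2,4) by auto
    then have k0: "k = 0 \<longleftrightarrow> k' = 0"
      using A.central_square_iff B.central_square_iff by simp
    show ?thesis
    proof (cases "k = 0")
      case False
      with k k0 True assms(2,4) show ?thesis
        by (auto simp: dihedral_parameters_def split: if_splits)
    next
      case True
      with k0 assms(2,4) have *: "(i, j, k) \<in> {(1, 0, 0), (1 + 2 * q, 0, 0)} \<inter> dihedral_parameters q"
        "(i', j', k') \<in> {(1, 0, 0), (1 + 2 * q, 0, 0)} \<inter> dihedral_parameters q"
        using A.q_pos by (auto simp: dihedral_parameters_def split: if_splits)
      then have "i = 1 \<longleftrightarrow> i' = 1"
        using A.two_central_iff B.two_central_iff by simp
      with * show ?thesis by auto
    qed
  qed
qed

section \<open>Existence\<close>

text \<open>The pair \<open>s^i\<close>, \<open>s^j t\<close> again satisfies the dihedral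
  relations, and it generates because \<open>i\<close> is its own inverse modulo \<open>N\<close>.
  By \<open>metacyclic_iso\<close> this yields the automorphism that \<open>e\<close> is to
  induce.\<close>

lemma metacyclic_dihedral_automorphism:
  fixes G (structure) and i j a N :: int
  assumes "metacyclic G s t N (- 1)" and i: "N dvd i * i - 1"
  shows "metacyclic G (s [^]\<^bsub>G\<^esub> i) (s [^]\<^bsub>G\<^esub> j \<otimes>\<^bsub>G\<^esub> t) N (- 1)"
    and "metacyclic_relations.elt G (s [^]\<^bsub>G\<^esub> i) (s [^]\<^bsub>G\<^esub> j \<otimes>\<^bsub>G\<^esub> t) (a, b) =
      metacyclic_relations.elt G s t (if b then i * a + j else i * a, b)"
proof -
  interpret metacyclic G s t N "- 1" by fact
  have pow: "(s [^] i) [^] a = s [^] (i * a)" for a :: int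
    by (simp add: int_pow_pow)
  interpret A: metacyclic_relations G "s [^] i" "s [^] j \<otimes> t" N "- 1"
    by unfold_locales (simp_all add: pow normalize s_pow_eq_one_iff)
  show elt: "A.elt (a, b) = elt (if b then i * a + j else i * a, b)" for a b
    by (simp add: A.elt_def elt_def pow normalize)
  show "metacyclic G (s [^] i) (s [^] j \<otimes> t) N (- 1)"
  proof
    show "N dvd a" if "(s [^] i) [^] a = \<one>" for a :: int
    proof -
      have "N dvd i * a" using that by (simp add: pow s_pow_eq_one_iff)
      then have "N dvd i * (i * a) - (i * i - 1) * a"
        using i by (intro dvd_diff) simp_all
      then show ?thesis by (simp add: algebra_simps)
    qed
    show "s [^] j \<otimes> t \<noteq> (s [^] i) [^] a" for a :: int
      by (simp add: pow s_pow_t_not_s_pow)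
    \<comment> \<open>Solves the coordinate formula for the old coordinates, with \<open>i\<close>
      in the role of its own inverse.\<close>
    have "elt (a, b) = A.elt (if b then i * (a - j) else i * a, b)" for a b
    proof -
      have "a - i * (i * a) = (i * i - 1) * (- a)"
        "a - (i * (i * (a - j)) + j) = (i * i - 1) * (j - a)"
        by (simp_all add: algebra_simps)
      then show ?thesis
        unfolding elt elt_eq_iff using i by simp
    qed
    then show "carrier G = range A.elt"
      unfolding carrier_eq using elt by (intro subset_antisym image_subsetI) (metis rangeI surj_pair)+
  qed
qed

text \<open>Converse of \<open>parameter_congruences\<close>: the first makes
  \<open>\<sigma>\<close> an automorphism, the first two together make its square conjugation by
  \<open>s^k\<close>, and the third makes \<open>s^k\<close> a fixed point.\<close>

lemma dihedral_extension_exists: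
  assumes q: "0 < q" and i: "4 * q dvd i * i - 1" and j: "4 * q dvd j * (i + 1) - 2 * k"
    and k: "4 * q dvd i * k - k"
  obtains E :: "((int \<times> bool) \<times> bool) monoid" and s t e where "dihedral_extension E s t q e i j k"
proof -
  obtain G :: "(int \<times> bool) monoid" and s t where "metacyclic G s t (4 * q) (- 1)"
    by (rule metacyclic_exists[of "4 * q" "- 1"]) (use q in simp_all)
  then interpret metacyclic G s t "4 * q" "- 1" .
  note aut = metacyclic_dihedral_automorphism[OF metacyclic_axioms i, of j]
  interpret A: metacyclic G "s [^]\<^bsub>G\<^esub> i" "s [^]\<^bsub>G\<^esub> j \<otimes>\<^bsub>G\<^esub> t" "4 * q" "- 1"
    by (rule aut)
  obtain \<sigma> where \<sigma>: "\<sigma> \<in> iso G G" "\<sigma> s = s [^]\<^bsub>G\<^esub> i" "\<sigma> t = s [^]\<^bsub>G\<^esub> j \<otimes>\<^bsub>G\<^esub> t"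
    by (rule metacyclic_iso[OF metacyclic_axioms aut(1)])
  have \<sigma>_hom: "\<sigma> \<in> hom G G" using \<sigma>(1) by (simp add: iso_def)
  have \<sigma>_elt: "\<sigma> (elt (a, b)) = elt (if b then i * a + j else i * a, b)" for a b
    using metacyclic_subgroup_image(2)[OF metacyclic_subgroup_axioms is_group \<sigma>(1), of "(a, b)"]
    by (simp add: \<sigma>(2,3) aut(2))
  have s_pow: "s [^]\<^bsub>G\<^esub> a = elt (a, False)" for a :: int
    by (simp add: elt_def)
  let ?E = "cyclic_extension G \<sigma> (s [^]\<^bsub>G\<^esub> k)"
  have gE: "group ?E"
  proof (rule group_cyclic_extension[OF is_group \<sigma>_hom])
    show "\<sigma> (s [^]\<^bsub>G\<^esub> k) = s [^]\<^bsub>G\<^esub> k"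
      using k by (simp add: s_pow \<sigma>_elt elt_eq_iff)
    show "\<sigma> (\<sigma> x) \<otimes>\<^bsub>G\<^esub> s [^]\<^bsub>G\<^esub> k = s [^]\<^bsub>G\<^esub> k \<otimes>\<^bsub>G\<^esub> x" if "x \<in> carrier G" for x
    proof -
      obtain a b where x: "x = elt (a, b)"
        using \<open>x \<in> carrier G\<close> by (auto simp: carrier_eq)
      have "4 * q dvd (i * i - 1) * a" using i by simp
      with dvd_add[OF this j] show ?thesis
        by (auto simp: x s_pow \<sigma>_elt elt_mult elt_eq_iff algebra_simps)
    qed
  qed simp
  have pow: "(s, False) [^]\<^bsub>?E\<^esub> a = (s [^]\<^bsub>G\<^esub> a, False)" for a :: int
    by (rule int_pow_cyclic_extension[OF is_group gE s_closed])
  interpret E: metacyclic_relations ?E "(s, False)" "(t, False)" "4 * q" "- 1"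
    by (rule metacyclic_relations.intro[OF gE], unfold_locales)
      (simp_all add: pow s_pow_N, simp_all add: cyclic_extension_simps t_t t_s)
  interpret E: metacyclic_subgroup ?E "(s, False)" "(t, False)" "4 * q" "- 1"
    by unfold_locales (simp_all add: pow t_not_s_pow cyclic_extension_simps s_pow_eq_one_iff)
  have elt_E: "E.elt x = (elt x, False)" for x
    by (cases x) (auto simp: E.elt_def elt_def pow cyclic_extension_simps)
  have "dihedral_extension ?E (s, False) (t, False) q (\<one>\<^bsub>G\<^esub>, True) i j k"
  proof unfold_locales
    have "range E.elt #>\<^bsub>?E\<^esub> (\<one>\<^bsub>G\<^esub>, True) = carrier G \<times> {True}"
      unfolding carrier_eq
      by (auto simp: r_coset_def elt_E cyclic_extension_simps elt_closed)
    moreover have "range E.elt = carrier G \<times> {False}"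
      by (auto simp: elt_E carrier_eq)
    ultimately show "carrier ?E = range E.elt \<union> (range E.elt #>\<^bsub>?E\<^esub> (\<one>\<^bsub>G\<^esub>, True))"
      by (auto simp: cyclic_extension_simps)
  qed (use q in \<open>auto simp: elt_E pow\<close>, simp_all add: cyclic_extension_simps \<sigma> hom_one[OF \<sigma>_hom])
  then show thesis by (rule that)
qed

lemma (in dihedral_extension) finite_carrier: "finite (carrier E)"
proof -
  have "ext_elt ((a, b), c) \<in> ext_elt ` (({0..<4 * q} \<times> UNIV) \<times> UNIV)" for a b c
    by (rule image_eqI[where x = "((a mod (4 * q), b), c)"])
      (use q_pos in \<open>simp_all add: ext_elt_eq_iff\<close>)
  then have "carrier E \<subseteq> ext_elt ` (({0..<4 * q} \<times> UNIV) \<times> UNIV)"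
    unfolding carrier_ext by auto
  then show ?thesis by (rule finite_subset) simp
qed

text \<open>The classes are counted among groups on the type \<open>'a\<close>, so the finite model
  is carried along a bijection to a finite subset of \<open>'a\<close>.\<close>

lemma dihedral_extension_exists_infinite:
  assumes "infinite (UNIV :: 'a set)" and params: "(i, j, k) \<in> dihedral_parameters q" and q: "0 < q"
  obtains E :: "'a monoid" and s t e where "dihedral_extension E s t q e i j k"
proof -
  have "i = 1 \<or> i = 1 + 2 * q \<and> j = 0 \<and> k = 0"
    and jk: "i = 1 \<Longrightarrow> 4 * q dvd 2 * (j - k)"
    using params by (auto simp: dihedral_parameters_def split: if_splits)
  moreover have "(1 + 2 * q) * (1 + 2 * q) - 1 = 4 * q * (1 + q)"
    by (simp add: algebra_simps)
  ultimately have "4 * q dvd i * i - 1" "4 * q dvd j * (i + 1) - 2 * k" "4 * q dvd i * k - k"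
    by (auto simp: algebra_simps)
  then obtain E :: "((int \<times> bool) \<times> bool) monoid" and s t e
    where "dihedral_extension E s t q e i j k"
    using dihedral_extension_exists[OF q] by blast
  then interpret dihedral_extension E s t q e i j k .
  obtain B :: "'a set" where "finite B" "card B = card (carrier E)"
    using infinite_arbitrarily_large[OF assms(1)] by blast
  then obtain f where "bij_betw f (carrier E) B"
    using finite_same_card_bij[OF finite_carrier] by metis
  then have f: "inj_on f (carrier E)" by (rule bij_betw_imp_inj_on)
  show thesis
    by (rule that, rule dihedral_extension_image(1)[OF dihedral_extension_axioms
          inj_imp_image_group_is_group[OF f] inj_imp_image_group_iso[OF f]])
qed

section \<open>Classification\<close>

lemma index_two_iff:
  assumes "group E" "subgroup D E"
  shows "degree_2_extension E D \<longleftrightarrow>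
    (\<exists>e. e \<in> carrier E - D \<and> carrier E = D \<union> (D #>\<^bsub>E\<^esub> e))" (is "_ \<longleftrightarrow> ?R")
proof -
  interpret group E by fact
  interpret D: subgroup D E by fact
  have un: "\<Union>(rcosets\<^bsub>E\<^esub> D) = carrier E" by (rule rcosets_part_G) fact
  have D: "D \<in> rcosets\<^bsub>E\<^esub> D"
    using coset_mult_one[OF D.subset] by (force simp: RCOSETS_def)
  show ?thesis
  proof
    assume "degree_2_extension E D"
    then have "card (rcosets\<^bsub>E\<^esub> D) = 2" by (simp add: degree_2_extension_def)
    then obtain A B where AB: "rcosets\<^bsub>E\<^esub> D = {A, B}" "A \<noteq> B"
      unfolding card_2_iff by blast
    with D have "D = A \<or> D = B" by simp
    with AB obtain C where C: "rcosets\<^bsub>E\<^esub> D = {D, C}" "C \<noteq> D"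
      by (metis insert_commute)
    then obtain e where e: "e \<in> carrier E" "C = D #>\<^bsub>E\<^esub> e"
      by (metis (no_types, lifting) RCOSETS_def UN_iff insertI1 insertI2 singletonD)
    then have "e \<notin> D" using C(2) coset_join2 assms(2) by blast
    with e un C show ?R by auto
  next
    assume ?R
    then obtain e where e: "e \<in> carrier E" "e \<notin> D" "carrier E = D \<union> (D #>\<^bsub>E\<^esub> e)" by blast
    have "D #>\<^bsub>E\<^esub> x \<in> {D, D #>\<^bsub>E\<^esub> e}" if "x \<in> carrier E" for x
      using that e coset_join2[OF that assms(2)] repr_independence[OF _ e(1) assms(2)] by blast
    then have "rcosets\<^bsub>E\<^esub> D = {D, D #>\<^bsub>E\<^esub> e}"
      using D e(1) by (auto simp: RCOSETS_def)
    moreover have "D \<noteq> D #>\<^bsub>E\<^esub> e"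
      using rcos_self[OF e(1) assms(2)] e(2) by blast
    ultimately show "degree_2_extension E D"
      using assms by (simp add: degree_2_extension_def)
  qed
qed

lemma index_two_coset:
  assumes "degree_2_extension E D" "e \<in> carrier E" "e \<notin> D"
  shows "carrier E = D \<union> (D #>\<^bsub>E\<^esub> e)"
proof -
  interpret group E using assms(1) by (simp add: degree_2_extension_def)
  have D: "subgroup D E" using assms(1) by (simp add: degree_2_extension_def)
  obtain x where x: "x \<in> carrier E" "carrier E = D \<union> (D #>\<^bsub>E\<^esub> x)"
    using assms(1) index_two_iff[OF is_group D] by blast
  then have "e \<in> D #>\<^bsub>E\<^esub> x" using assms by blast
  with x repr_independence[OF _ x(1) D] show ?thesis by simp
qed

text \<open>For \<open>x\<close> outside \<open>D\<close>, the product \<open>x h\<close> lies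
  outside \<open>D\<close> as well, hence in the only other coset, which is that of
  \<open>x\<close>.\<close>

lemma index_two_normal:
  assumes "degree_2_extension E D"
  shows "D \<lhd> E"
proof -
  interpret group E using assms by (simp add: degree_2_extension_def)
  interpret D: subgroup D E using assms by (simp add: degree_2_extension_def)
  show ?thesis
  proof (rule normal_invI[OF D.subgroup_axioms])
    fix x h assume x: "x \<in> carrier E" and h: "h \<in> D"
    show "x \<otimes>\<^bsub>E\<^esub> h \<otimes>\<^bsub>E\<^esub> inv\<^bsub>E\<^esub> x \<in> D"
    proof (cases "x \<in> D")
      case False
      have "x \<otimes>\<^bsub>E\<^esub> h \<notin> D"
      proof
        assume "x \<otimes>\<^bsub>E\<^esub> h \<in> D"
        then have "x \<otimes>\<^bsub>E\<^esub> h \<otimes>\<^bsub>E\<^esub> inv\<^bsub>E\<^esub> h \<in> D" using h by simp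
        with False x h show False by (simp add: m_assoc)
      qed
      moreover have "x \<otimes>\<^bsub>E\<^esub> h \<in> carrier E" using x h by simp
      ultimately obtain y where y: "y \<in> D" "x \<otimes>\<^bsub>E\<^esub> h = y \<otimes>\<^bsub>E\<^esub> x"
        unfolding index_two_coset[OF assms x False] by (auto simp: r_coset_def)
      then show ?thesis using x by (simp add: m_assoc)
    qed (use h in simp)
  qed
qed

lemma not_4_dvd_square_plus_one: "\<not> 4 dvd i * i + 1" for i :: int
proof (cases "even i")
  case True
  then obtain x where "i = 2 * x" ..
  then have "i * i + 1 = 4 * (x * x) + 1" by simp
  then show ?thesis by presburger
next
  case False
  then obtain x where "i = 2 * x + 1" ..
  then have "i * i + 1 = 4 * (x * x + x) + 2" by (simp add: algebra_simps)
  then show ?thesis by presburger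
qed

text \<open>Normality of \<open>D\<close> gives \<open>e s\<close>, \<open>e t\<close> and
  \<open>e^2\<close> with unknown reflection parts \<open>b\<close>, \<open>b'\<close> and
  \<open>b''\<close>. The work is to settle these three bits.\<close>

lemma dihedral_extension_of_index_two:
  fixes E :: "'a monoid" (structure)
  assumes "metacyclic_subgroup E s t (4 * q) (- 1)" "0 < q"
    and ext: "degree_2_extension E (range (metacyclic_relations.elt E s t))"
  obtains e i j k where "dihedral_extension E s t q e i j k"
proof -
  interpret metacyclic_subgroup E s t "4 * q" "- 1" by fact
  obtain e where e [simp]: "e \<in> carrier E" and e_notin: "e \<notin> range elt"
    using ext index_two_iff[OF is_group subgroup_range_elt] by blast
  note carrier = index_two_coset[OF ext e e_notin]
  note [simp] = elt_closed
  have not_dvd: "\<not> 4 * q dvd 2"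
    using zdvd_imp_le[of "4 * q" 2] \<open>0 < q\<close> by auto
  have coset: "\<exists>y. e \<otimes> elt x = elt y \<otimes> e" for x
  proof -
    have "e \<otimes> elt x \<otimes> inv e \<in> range elt"
      by (rule normal.inv_op_closed2[OF index_two_normal[OF ext] e rangeI])
    then obtain y where "e \<otimes> elt x \<otimes> inv e = elt y" by blast
    then have "e \<otimes> elt x = elt y \<otimes> e" by (simp add: inv_solve_right')
    then show ?thesis ..
  qed
  have s: "elt (1, False) = s" and t: "elt (0, True) = t" and one: "elt (0, False) = \<one>"
    by (simp_all add: elt_def)
  obtain i b where e_s: "e \<otimes> s = elt (i, b) \<otimes> e"
    using coset[of "(1, False)"] by (auto simp: s)
  obtain j b' where e_t: "e \<otimes> t = elt (j, b') \<otimes> e"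
    using coset[of "(0, True)"] by (auto simp: t)
  \<comment> \<open>A reflection as image of \<open>s\<close> would be an involution, whereas
    \<open>s^2\<close> is not \<open>\<one>\<close>.\<close>
  have "\<not> b"
  proof
    assume b
    have "e \<otimes> (s \<otimes> s) = e \<otimes> s \<otimes> s"
      by (simp add: m_assoc)
    also have "\<dots> = elt (i, b) \<otimes> (e \<otimes> s)"
      by (subst e_s) (simp add: m_assoc)
    also have "\<dots> = elt (i, b) \<otimes> elt (i, b) \<otimes> e"
      by (simp add: e_s m_assoc)
    also have "\<dots> = e"
      using \<open>b\<close> by (simp add: elt_mult one)
    finally have "s \<otimes> s = \<one>" by simp
    then have "elt (2, False) = elt (0, False)"
      using elt_mult[of "(1, False)" "(1, False)"] by (simp add: s one)
    with not_dvd show False by (simp add: elt_eq_iff)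
  qed
  \<comment> \<open>If \<open>t\<close> also went to a rotation, the images of \<open>s\<close> and
    \<open>t\<close>, and hence \<open>s\<close> and \<open>t\<close> themselves, would
    commute.\<close>
  have b'
  proof (rule ccontr)
    assume "\<not> b'"
    have "e \<otimes> (s \<otimes> t) = elt (i, b) \<otimes> elt (j, b') \<otimes> e"
      by (simp add: e_s e_t m_assoc flip: m_assoc[of e s t])
    also have "\<dots> = elt (j, b') \<otimes> elt (i, b) \<otimes> e"
      using \<open>\<not> b\<close> \<open>\<not> b'\<close> by (simp add: elt_mult add.commute)
    also have "\<dots> = e \<otimes> (t \<otimes> s)"
      by (simp add: e_s e_t m_assoc flip: m_assoc[of e t s])
    finally have "elt (1, True) = elt (- 1, True)"
      using elt_mult[of "(1, False)" "(0, True)"] elt_mult[of "(0, True)" "(1, False)"]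
      by (simp add: s t)
    with not_dvd show False by (simp add: elt_eq_iff)
  qed
  have "e \<otimes> e \<notin> range elt #> e"
  proof
    assume "e \<otimes> e \<in> range elt #> e"
    then obtain x where "e \<otimes> e = elt x \<otimes> e" by (auto simp: r_coset_def)
    with e_notin show False by simp
  qed
  moreover have "e \<otimes> e \<in> carrier E" by simp
  ultimately obtain k b'' where e_e: "e \<otimes> e = elt (k, b'')"
    unfolding carrier by auto
  have "\<not> b''"
  proof
    assume b''
    have "elt (k, b'') \<otimes> s = e \<otimes> (e \<otimes> s)"
      by (simp add: m_assoc flip: e_e)
    also have "\<dots> = e \<otimes> elt (i, b) \<otimes> e"
      by (simp add: e_s m_assoc)
    also have "e \<otimes> elt (i, b) = elt (i * i, False) \<otimes> e"
    proof -
      have "e \<otimes> s [^] i = s [^] (i * i) \<otimes> e"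
        by (rule int_pow_conjugate) (use \<open>\<not> b\<close> e_s in \<open>simp_all add: elt_def\<close>)
      then show ?thesis using \<open>\<not> b\<close> by (simp add: elt_def)
    qed
    also have "elt (i * i, False) \<otimes> e \<otimes> e = elt (i * i, False) \<otimes> elt (k, b'')"
      by (simp add: m_assoc e_e)
    finally have "elt (k - 1, True) = elt (i * i + k, True)"
      using elt_mult[of "(k, True)" "(1, False)"] \<open>b''\<close> by (simp add: s elt_mult)
    then have "4 * q dvd k - 1 - (i * i + k)"
      unfolding elt_eq_iff by simp
    also have "k - 1 - (i * i + k) = - (i * i + 1)" by simp
    finally have "4 * q dvd i * i + 1" unfolding dvd_minus_iff .
    then have "4 dvd i * i + 1" by (rule dvd_mult_left)
    with not_4_dvd_square_plus_one show False by blast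
  qed
  have "elt (i, b) = s [^] i" "elt (j, b') = s [^] j \<otimes> t" "elt (k, b'') = s [^] k"
    using \<open>\<not> b\<close> \<open>b'\<close> \<open>\<not> b''\<close> by (simp_all add: elt_def)
  with \<open>0 < q\<close> e_notin e_s e_t e_e have "dihedral_extension E s t q e i j k"
    by unfold_locales (simp_all, rule carrier)
  then show thesis by (rule that)
qed

text \<open>With \<open>i = 2x + 1\<close> the hypothesis says that \<open>2^n\<close> divides
  \<open>x (x + 1)\<close>, and only one of the two factors can be even.\<close>

lemma square_one_mod_power_of_two:
  fixes i :: int
  assumes "4 * 2 ^ n dvd i * i - 1"
  shows "2 * 2 ^ n dvd i - 1 \<or> 2 * 2 ^ n dvd i + 1"
proof -
  have "even (i * i - 1)"
    using assms by (meson dvd_mult2 dvd_trans even_numeral)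
  then have "odd i" by simp
  then obtain x where x: "i = 2 * x + 1" ..
  have "4 * 2 ^ n dvd 4 * (x * (x + 1))"
    using assms by (simp add: x algebra_simps)
  then have dvd: "2 ^ n dvd x * (x + 1)"
    by (subst (asm) dvd_mult_cancel_left) simp
  show ?thesis
  proof (cases "even x")
    case True
    then have "coprime (2 ^ n) (x + 1)" by simp
    with dvd have "2 ^ n dvd x" by (simp add: coprime_dvd_mult_left_iff)
    then show ?thesis by (simp add: x)
  next
    case False
    then have "coprime (2 ^ n) x" by simp
    with dvd have "2 ^ n dvd x + 1" by (simp add: coprime_dvd_mult_right_iff)
    then have "2 * 2 ^ n dvd 2 * (x + 1)" by (rule mult_dvd_mono[OF dvd_refl])
    then show ?thesis by (simp add: x algebra_simps)
  qed
qed

lemma dihedral_classification: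
  assumes "dihedral_extension E s t q e i j k" and q: "q = 2 ^ n"
  obtains t' e' i' j' k' where "dihedral_extension E s t' q e' i' j' k'"
    and "(i', j', k') \<in> dihedral_parameters q"
    and "range (metacyclic_relations.elt E s t') = range (metacyclic_relations.elt E s t)"
proof -
  interpret dihedral_extension E s t q e i j k by fact
  have q1: "q = 1 \<or> even q" by (cases n) (simp_all add: q)
  have q0: "\<not> 4 * q dvd 2 * q" using not_4q_dvd[of "2 * q"] q_pos by simp
  \<comment> \<open>Replacing \<open>e\<close> by \<open>te\<close> if necessary chooses the sign of
    \<open>i\<close>.\<close>
  obtain e1 i1 j1 k1 where ext1: "dihedral_extension E s t q e1 i1 j1 k1" and "2 * q dvd i1 - 1"
    using square_one_mod_power_of_two[of n i] parameter_congruences(1)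
      dihedral_extension_axioms change_complement_t dvd_minus_iff[of "2 * q" "i + 1"]
    by (auto simp: q)
  then obtain m where m: "i1 = 1 + 2 * q * m"
    by (metis add.commute diff_add_cancel dvdE)
  obtain e2 i2 j2 k2 where ext2: "dihedral_extension E s t q e2 i2 j2 k2"
    and i2: "i2 = 1 \<or> i2 = 1 + 2 * q \<and> even q"
  proof (cases "even m")
    case True
    then have "4 * q dvd i1 - 1" by (auto simp: m)
    then show thesis
      using that dihedral_extension.change_parameters[OF ext1, of 1 j1 k1] by simp
  next
    case False
    then have dvd: "4 * q dvd i1 - (1 + 2 * q)" by (auto simp: m algebra_simps elim!: oddE)
    show thesis
    proof (cases "even q")
      case True
      with dvd show thesis
        using that dihedral_extension.change_parameters[OF ext1, of "1 + 2 * q" j1 k1] by simp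
    next
      case False
      \<comment> \<open>Modulo 4 the value 3 is -1, so another passage to \<open>te\<close> gives
        \<open>i = 1\<close>.\<close>
      with q1 have "q = 1" by simp
      with dvd have "4 * q dvd i1 - 3" by simp
      then have "4 * q dvd - i1 - 1"
        unfolding \<open>q = 1\<close> by presburger
      then show thesis
        using that dihedral_extension.change_parameters[
            OF dihedral_extension.change_complement_t[OF ext1], of 1 "- j1" "k1 - j1"] by simp
    qed
  qed
  define j3 where "j3 = j2 mod 2"
  have j3: "j3 = 0 \<or> j3 = 1" by (auto simp: j3_def)
  have "j2 + 2 * (- (j2 div 2)) = j3" by (simp add: j3_def minus_mult_div_eq_mod [symmetric])
  then obtain e3 k3 where ext3: "dihedral_extension E s t q e3 i2 j3 k3"
    using dihedral_extension.change_complement_s[OF ext2, of "- (j2 div 2)"] by metis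
  interpret ext3: dihedral_extension E s t q e3 i2 j3 k3 by (rule ext3)
  have jk: "4 * q dvd j3 * (i2 + 1) - 2 * k3" by (rule ext3.parameter_congruences)
  have half: "4 * q dvd x \<or> 4 * q dvd x - 2 * q" if "4 * q dvd 2 * x" for x
  proof -
    have "2 * (2 * q) dvd 2 * x" using that by simp
    then have "2 * q dvd x" by (subst (asm) dvd_mult_cancel_left) simp
    then obtain y where y: "x = 2 * q * y" ..
    show ?thesis
      by (cases "even y") (auto simp: y algebra_simps elim!: evenE oddE)
  qed
  have ev: "even x" if "4 * q dvd x" for x
    by (rule dvd_trans[OF _ that]) simp
  from i2 show thesis
  proof
    assume i: "i2 = 1"
    have "4 * q dvd 2 * (k3 - j3)"
      using jk by (simp add: i dvd_diff_commute algebra_simps)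
    then have k: "4 * q dvd k3 - j3 \<or> 4 * q dvd k3 - (j3 + 2 * q)"
      using half[of "k3 - j3"] by (simp add: algebra_simps)
    have "dihedral_extension E s t q e3 i2 j3 j3 \<or> dihedral_extension E s t q e3 i2 j3 (j3 + 2 * q)"
      using k ext3.change_parameters[of i2 j3 j3] ext3.change_parameters[of i2 j3 "j3 + 2 * q"] by auto
    moreover have "(i2, j3, j3) \<in> dihedral_parameters q" "(i2, j3, j3 + 2 * q) \<in> dihedral_parameters q"
      using i j3 by (auto simp: dihedral_parameters_def)
    ultimately show thesis using that by blast
  next
    assume i: "i2 = 1 + 2 * q \<and> even q"
    \<comment> \<open>For \<open>i = 1 + 2q\<close> the relation \<open>ik = k\<close> reads
      \<open>2 q k = 0\<close> modulo \<open>4q\<close>, so \<open>k\<close> is even.\<close>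
    have "4 * q dvd i2 * k3 - k3" by (rule ext3.parameter_congruences)
    then have "2 * q * 2 dvd 2 * q * k3"
      using i by (simp add: algebra_simps)
    then have "even k3"
      using q_pos by (subst (asm) dvd_mult_cancel_left) simp
    \<comment> \<open>For \<open>j = 1\<close> the relation \<open>j(i + 1) = 2k\<close> gives
      \<open>k = 1 + q\<close> modulo \<open>2q\<close>, which is odd because \<open>q\<close> is
      even.\<close>
    moreover have "j3 = 1 \<Longrightarrow> odd k3"
    proof
      assume "j3 = 1" "even k3"
      with jk i have "4 * q dvd 2 * (1 + q - k3)" by (simp add: algebra_simps)
      then have "even (1 + q - k3)"
        using half[of "1 + q - k3"] ev[of "1 + q - k3"] ev[of "1 + q - k3 - 2 * q"] by auto
      with i \<open>even k3\<close> show False by simp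
    qed
    ultimately have j: "j3 = 0" using j3 by blast
    obtain p where p: "q = 2 * p" using i by blast
    from j have "4 * q dvd k3 \<or> 4 * q dvd k3 - 2 * q"
      using jk half[of k3] by simp
    then show thesis
    proof
      assume "4 * q dvd k3"
      then have "dihedral_extension E s t q e3 (1 + 2 * q) 0 0"
        using ext3.change_parameters[of i2 j3 0] i j by simp
      then show thesis
        using that i by (auto simp: dihedral_parameters_def)
    next
      assume k: "4 * q dvd k3 - 2 * q"
      \<comment> \<open>The quarter turn changes \<open>k\<close> by
        \<open>q (1 + i) = 2q + 2 q^2\<close>, which is \<open>2q\<close> modulo \<open>4q\<close>
        as \<open>q\<close> is even, and so cancels it. It makes \<open>j = 2q\<close>, which
        passing to \<open>st\<close> removes.\<close>
      let ?e = "s [^]\<^bsub>E\<^esub> q \<otimes>\<^bsub>E\<^esub> e3"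
      have ext4: "dihedral_extension E s t q ?e i2 (2 * q) (k3 + q * (1 + i2))"
        using ext3.change_complement_s[of q] j by simp
      have "k3 + q * (1 + i2) = (k3 - 2 * q) + 4 * q * (1 + p)"
        using i p by (simp add: algebra_simps)
      also have "4 * q dvd \<dots>"
        by (rule dvd_add[OF k]) simp
      finally have "4 * q dvd k3 + q * (1 + i2)" .
      then have "dihedral_extension E s (s \<otimes>\<^bsub>E\<^esub> t) q ?e (1 + 2 * q) 0 0"
        using dihedral_extension.change_parameters[OF
            dihedral_extension.change_reflection(1)[OF ext4], of "1 + 2 * q" 0 0] i by simp
      then show thesis
        using that[of "s \<otimes>\<^bsub>E\<^esub> t"] i ext3.change_reflection(2)
        by (auto simp: dihedral_parameters_def)
    qed
  qed
qed

section \<open>Parameter triples as isomorphism classes of extensions\<close>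

definition normal_form :: "int \<Rightarrow> int \<times> int \<times> int \<Rightarrow> ('a monoid \<times> 'a set) set" where
  "normal_form q p = {(E, D). \<exists>s t e. D = range (metacyclic_relations.elt E s t) \<and>
     dihedral_extension E s t q e (fst p) (fst (snd p)) (snd (snd p))}"

text \<open>Both directions go through the metacyclic description of the presented group:
  isomorphisms transport it, and it determines an isomorphism matching the generators.\<close>

lemma dihedral_gens_iff:
  assumes "group E" "subgroup D E"
  shows "dihedral_gens d E D s t \<longleftrightarrow>
    metacyclic_subgroup E s t (2 ^ (d - 1)) (- 1) \<and> D = range (metacyclic_relations.elt E s t)"
proof -
  have "dihedral_gens d E D s t \<longleftrightarrow> metacyclic (E\<lparr>carrier := D\<rparr>) s t (2 ^ (d - 1)) (- 1)"
  proof
    assume "dihedral_gens d E D s t"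
    then show "metacyclic (E\<lparr>carrier := D\<rparr>) s t (2 ^ (d - 1)) (- 1)"
      unfolding dihedral_gens_def
      using metacyclic_image[OF metacyclic_dihedral_group group.subgroup_imp_group[OF assms]] by blast
  next
    assume "metacyclic (E\<lparr>carrier := D\<rparr>) s t (2 ^ (d - 1)) (- 1)"
    then show "dihedral_gens d E D s t"
      unfolding dihedral_gens_def
      by (rule metacyclic_iso[OF metacyclic_dihedral_group]) blast
  qed
  then show ?thesis by (simp add: metacyclic_of_subgroup_iff[OF assms])
qed

lemma dihedral_extensions_iff:
  "(E, D) \<in> dihedral_extensions d \<longleftrightarrow> degree_2_extension E D \<and> (\<exists>s t. dihedral_gens d E D s t)"
proof -
  have "E\<lparr>carrier := D\<rparr> \<cong> dihedral_group d \<longleftrightarrow> (\<exists>s t. dihedral_gens d E D s t)"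
    if "group E" "subgroup D E"
    using group.iso_sym[OF group.subgroup_imp_group[OF that], of "dihedral_group d"]
      group.iso_sym[OF group_presented_group, of "dihedral_relators d" "E\<lparr>carrier := D\<rparr>"]
    by (auto simp: dihedral_gens_def is_iso_def simp flip: dihedral_group_def)
  then show ?thesis
    by (auto simp: dihedral_extensions_def degree_2_extension_def)
qed

context
  fixes d :: nat and q :: int
  assumes d: "3 \<le> d" and q: "q = 2 ^ (d - 3)"
begin

lemma order_rotation: "2 ^ (d - 1) = 4 * q" and order_half: "int (2 ^ (d - 2)) = 2 * q"
proof -
  obtain n where "d = n + 3" using d by (metis add.commute le_Suc_ex)
  then show "2 ^ (d - 1) = 4 * q" "int (2 ^ (d - 2)) = 2 * q"
    by (simp_all add: q)
qed

lemma q_pos: "0 < q" by (simp add: q)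

lemma normal_formI:
  fixes E :: "'a monoid" (structure)
  assumes ext: "degree_2_extension E D" and gens: "dihedral_gens d E D s t"
    and e: "e \<in> carrier E" "e \<notin> D"
    and rel: "e \<otimes> s = s [^] i \<otimes> e" "e \<otimes> t = s [^] j \<otimes> t \<otimes> e" "e \<otimes> e = s [^] k"
  shows "(E, D) \<in> normal_form q (i, j, k)"
proof -
  have "group E" "subgroup D E" using ext by (simp_all add: degree_2_extension_def)
  note gens = gens[unfolded dihedral_gens_iff[OF this] order_rotation]
  interpret metacyclic_subgroup E s t "4 * q" "- 1" using gens by simp
  have D: "D = range elt" using gens by simp
  have "dihedral_extension E s t q e i j k"
    by unfold_locales
      (use q_pos e rel index_two_coset[OF ext e] in \<open>simp_all only: D not_False_eq_True\<close>)
  then show ?thesis using D by (auto simp: normal_form_def)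
qed

lemma normal_formE:
  assumes "(E, D) \<in> normal_form q (i, j, k)"
  obtains s t e where "dihedral_extension E s t q e i j k"
    "D = range (metacyclic_relations.elt E s t)" "dihedral_gens d E D s t"
    "degree_2_extension E D" "(E, D) \<in> dihedral_extensions d"
proof -
  obtain s t e where "dihedral_extension E s t q e i j k"
    and D: "D = range (metacyclic_relations.elt E s t)"
    using assms by (auto simp: normal_form_def)
  then interpret dihedral_extension E s t q e i j k by simp
  have gens: "dihedral_gens d E D s t"
    unfolding D dihedral_gens_iff[OF is_group subgroup_range_elt] order_rotation
    using metacyclic_subgroup_axioms by simp
  have "degree_2_extension E D"
    unfolding D index_two_iff[OF is_group subgroup_range_elt]
    using e_closed e_notin carrier_E by blast
  with gens dihedral_extension_axioms D that show thesis
    unfolding dihedral_extensions_iff by blast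
qed

lemma normal_form_subset: "normal_form q p \<subseteq> dihedral_extensions d"
proof -
  obtain i j k where "p = (i, j, k)" by (cases p)
  then show ?thesis by (auto elim: normal_formE)
qed

lemma normal_form_cover:
  assumes "(E, D) \<in> dihedral_extensions d"
  obtains p where "p \<in> dihedral_parameters q" "(E, D) \<in> normal_form q p"
proof -
  obtain s t where ext: "degree_2_extension E D" and gens: "dihedral_gens d E D s t"
    using assms unfolding dihedral_extensions_iff by blast
  have "group E" "subgroup D E" using ext by (simp_all add: degree_2_extension_def)
  note gens = gens[unfolded dihedral_gens_iff[OF this] order_rotation]
  obtain e i j k where "dihedral_extension E s t q e i j k"
    by (rule dihedral_extension_of_index_two[of E s t q]) (use gens ext q_pos in auto)
  from dihedral_classification[OF this q] obtain t' e' i' j' k'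
    where "dihedral_extension E s t' q e' i' j' k'" "(i', j', k') \<in> dihedral_parameters q"
      and "range (metacyclic_relations.elt E s t') = D"
    using gens by metis
  then show thesis
    using that[of "(i', j', k')"] by (force simp: normal_form_def)
qed

lemma normal_form_iso:
  "(E, D) \<in> normal_form q p \<Longrightarrow> (E', D') \<in> normal_form q p \<Longrightarrow> E \<cong> E'"
  unfolding normal_form_def by clarify (rule dihedral_extension_iso)

lemma normal_form_unique:
  assumes "(E, D) \<in> normal_form q p" "p \<in> dihedral_parameters q"
    and "(E', D') \<in> normal_form q p'" "p' \<in> dihedral_parameters q" and "E \<cong> E'"
  shows "p = p'"
proof -
  obtain i j k where p: "p = (i, j, k)" by (cases p)
  obtain i' j' k' where p': "p' = (i', j', k')" by (cases p')
  obtain s t e where ext: "dihedral_extension E s t q e i j k"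
    using assms(1) by (auto simp: normal_form_def p)
  obtain s' t' e' where ext': "dihedral_extension E' s' t' q e' i' j' k'"
    using assms(3) by (auto simp: normal_form_def p')
  interpret E': dihedral_extension E' s' t' q e' i' j' k' by fact
  obtain \<phi> where "\<phi> \<in> iso E E'" using \<open>E \<cong> E'\<close> by (auto simp: is_iso_def)
  from dihedral_parameters_unique[OF dihedral_extension_image(1)[OF ext E'.is_group this] _ ext']
  show ?thesis using assms(2,4) by (simp add: p p')
qed

lemma normal_form_nonempty:
  assumes "infinite (UNIV :: 'a set)" "p \<in> dihedral_parameters q"
  shows "(normal_form q p :: ('a monoid \<times> 'a set) set) \<noteq> {}"
proof -
  obtain i j k where p: "p = (i, j, k)" by (cases p)
  obtain E :: "'a monoid" and s t e where "dihedral_extension E s t q e i j k"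
    by (rule dihedral_extension_exists_infinite[OF assms(1) assms(2)[unfolded p] q_pos])
  then show ?thesis by (auto simp: normal_form_def p)
qed

text \<open>The normal forms cover all extensions, each lies in one class, and different triples
  give nonisomorphic groups. Infinity of \<open>'a\<close> makes every normal form nonempty; hence
  each is a class, and distinct triples give distinct sets.\<close>

lemma extension_classes_eq:
  assumes inf: "infinite (UNIV :: 'a set)"
  shows "(extension_classes d :: ('a monoid \<times> 'a set) set set) = normal_form q ` dihedral_parameters q"
    and "inj_on (normal_form q :: _ \<Rightarrow> ('a monoid \<times> 'a set) set) (dihedral_parameters q)"
proof -
  have cls: "extension_iso d `` {(E, D)} = normal_form q p"
    if "(E, D) \<in> normal_form q p" "p \<in> dihedral_parameters q" for E :: "'a monoid" and D p
  proof (intro subset_antisym subrelI)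
    fix E' :: "'a monoid" and D' assume "(E', D') \<in> extension_iso d `` {(E, D)}"
    then have iso: "E \<cong> E'" and "(E', D') \<in> dihedral_extensions d"
      by (auto simp: extension_iso_def)
    then obtain p' where "p' \<in> dihedral_parameters q" "(E', D') \<in> normal_form q p'"
      using normal_form_cover by blast
    with that iso normal_form_unique show "(E', D') \<in> normal_form q p" by blast
  next
    fix E' :: "'a monoid" and D' assume "(E', D') \<in> normal_form q p"
    with that show "(E', D') \<in> extension_iso d `` {(E, D)}"
      using normal_form_subset[of p] normal_form_iso[of E D p E' D'] by (auto simp: extension_iso_def)
  qed
  show "(extension_classes d :: ('a monoid \<times> 'a set) set set) = normal_form q ` dihedral_parameters q"
  proof (intro subset_antisym subsetI)
    fix C :: "('a monoid \<times> 'a set) set" assume "C \<in> extension_classes d"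
    then obtain E D where ED: "(E, D) \<in> dihedral_extensions d" and C: "C = extension_iso d `` {(E, D)}"
      by (auto simp: extension_classes_def quotient_def)
    obtain p where "p \<in> dihedral_parameters q" "(E, D) \<in> normal_form q p"
      by (rule normal_form_cover[OF ED])
    then show "C \<in> normal_form q ` dihedral_parameters q"
      unfolding C using cls[of E D p] by (intro image_eqI)
  next
    fix C :: "('a monoid \<times> 'a set) set" assume "C \<in> normal_form q ` dihedral_parameters q"
    then obtain p where p: "p \<in> dihedral_parameters q" "C = normal_form q p" by blast
    then obtain E D where "(E, D) \<in> C" using normal_form_nonempty[OF inf, of p] by auto
    then have "C = extension_iso d `` {(E, D)}" "(E, D) \<in> dihedral_extensions d"
      using p cls[of E D p] normal_form_subset[of p] by auto
    then show "C \<in> extension_classes d"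
      by (simp add: extension_classes_def quotientI)
  qed
  show "inj_on (normal_form q :: _ \<Rightarrow> ('a monoid \<times> 'a set) set) (dihedral_parameters q)"
  proof (rule inj_onI)
    fix p p'
    assume "p \<in> dihedral_parameters q" "p' \<in> dihedral_parameters q"
      and "(normal_form q p :: ('a monoid \<times> 'a set) set) = normal_form q p'"
    moreover obtain E D where "(E, D) \<in> (normal_form q p :: ('a monoid \<times> 'a set) set)"
      using normal_form_nonempty[OF inf, of p] calculation(1) by auto
    ultimately show "p = p'"
      using normal_form_unique[of E D p E D p'] by simp
  qed
qed

end

section \<open>Identification of the five types with parameter triples\<close>

lemma (in monoid) nat_pow_square: "x \<in> carrier G \<Longrightarrow> x [^] (2 :: nat) = x \<otimes> x"
  by (simp add: numeral_2_eq_2)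

lemma (in group) generate_involution:
  assumes "e \<in> carrier G" "e \<otimes> e = \<one>"
  shows "generate G {e} = {\<one>, e}"
proof
  have "subgroup {\<one>, e} G"
    using assms by (intro subgroupI) (auto simp: inv_equality)
  then show "generate G {e} \<subseteq> {\<one>, e}"
    by (intro generate_subgroup_incl) simp_all
qed (auto intro: generate.intros)

lemma internal_direct_product_involution:
  fixes E (structure)
  assumes "group E" "subgroup D E" and e: "e \<in> centralizer E D" "e \<notin> D" "e \<otimes> e = \<one>"
    and carrier: "carrier E = D \<union> (D #> e)"
  shows "internal_direct_product E D (generate E {e})"
proof -
  interpret group E by fact
  interpret D: subgroup D E by fact
  have e_closed [simp]: "e \<in> carrier E" and comm: "\<And>x. x \<in> D \<Longrightarrow> e \<otimes> x = x \<otimes> e"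
    using e(1) by (auto simp: centralizer_def)
  have gen: "generate E {e} = {\<one>, e}" by (rule generate_involution) (simp_all add: e)
  let ?f = "\<lambda>(a, b). a \<otimes> b"
  let ?P = "E\<lparr>carrier := D\<rparr> \<times>\<times> E\<lparr>carrier := {\<one>, e}\<rparr>"
  have "?f \<in> hom ?P E"
  proof (rule homI)
    fix x y assume "x \<in> carrier ?P" "y \<in> carrier ?P"
    then obtain a b a' b' where x: "x = (a, b)" "a \<in> D" "b \<in> {\<one>, e}"
      and y: "y = (a', b')" "a' \<in> D" "b' \<in> {\<one>, e}"
      by (auto simp: DirProd_def)
    have c: "a \<in> carrier E" "a' \<in> carrier E" "b \<in> carrier E" "b' \<in> carrier E"
      using x y by auto
    have ba: "b \<otimes> a' = a' \<otimes> b"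
      using x(3) comm[OF y(2)] c by auto
    have "?f (x \<otimes>\<^bsub>?P\<^esub> y) = a \<otimes> (a' \<otimes> b) \<otimes> b'"
      using c by (simp add: x y m_assoc)
    also have "\<dots> = ?f x \<otimes> ?f y"
      unfolding ba[symmetric] using c by (simp add: x y m_assoc)
    finally show "?f (x \<otimes>\<^bsub>?P\<^esub> y) = ?f x \<otimes> ?f y" .
  qed (auto simp: DirProd_def)
  moreover have "bij_betw ?f (carrier ?P) (carrier E)"
  proof (rule bij_betwI')
    fix x y assume "x \<in> carrier ?P" "y \<in> carrier ?P"
    then obtain a b a' b' where x: "x = (a, b)" "a \<in> D" "b \<in> {\<one>, e}"
      and y: "y = (a', b')" "a' \<in> D" "b' \<in> {\<one>, e}"
      by (auto simp: DirProd_def)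
    have notin: "c \<otimes> e \<notin> D" if "c \<in> D" for c
    proof
      assume "c \<otimes> e \<in> D"
      then have "inv c \<otimes> (c \<otimes> e) \<in> D" using that by simp
      with that e(2) show False by (simp flip: m_assoc)
    qed
    show "?f x = ?f y \<longleftrightarrow> x = y"
      using x y notin[of a] notin[of a'] by auto
  next
    fix x assume "x \<in> carrier ?P"
    then show "?f x \<in> carrier E" by (auto simp: DirProd_def)
  next
    fix y assume "y \<in> carrier E"
    then consider "y \<in> D" | a where "a \<in> D" "y = a \<otimes> e"
      unfolding carrier by (auto simp: r_coset_def)
    then show "\<exists>x\<in>carrier ?P. y = ?f x"
      by cases (force simp: DirProd_def)+
  qed
  ultimately have "?f \<in> iso ?P E" by (simp add: iso_def)
  moreover have "subgroup (generate E {e}) E" by (rule generate_is_subgroup) simp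
  ultimately show ?thesis
    unfolding internal_direct_product_def gen using D.subgroup_axioms by simp
qed

context dihedral_extension
begin

lemma carrier_eq_set_mult: "carrier E = range elt <#> generate E {e}"
proof
  interpret D: subgroup "range elt" E by (rule subgroup_range_elt)
  show "carrier E \<subseteq> range elt <#> generate E {e}"
  proof
    fix x assume "x \<in> carrier E"
    then obtain y c where "x = ext_elt (y, c)"
      unfolding carrier_ext by fast
    then have x: "x = elt y \<otimes> (if c then e else \<one>)"
      by (simp add: ext_elt_def)
    have "(if c then e else \<one>) \<in> generate E {e}"
      by (auto intro: generate.intros)
    then show "x \<in> range elt <#> generate E {e}"
      unfolding set_mult_def x by blast
  qed
  show "range elt <#> generate E {e} \<subseteq> carrier E"
    using D.subset generate_in_carrier[of "{e}"] by (auto simp: set_mult_def elt_closed)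
qed

text \<open>Since \<open>k\<close> is its own inverse modulo \<open>4q\<close>,
  \<open>e^2 = s^k\<close> gives \<open>s = e^(2k)\<close>, so \<open>e\<close> has order
  \<open>8q\<close> and generates \<open>E\<close> together with \<open>t\<close>. From
  \<open>t e = s^(-1) e t\<close> one reads off \<open>r = 1 - 2k\<close>: this is -1 for
  \<open>k = 1\<close>, and \<open>4q - 1\<close> modulo \<open>8q\<close> for
  \<open>k = 1 + 2q\<close>.\<close>

lemma metacyclic_complement:
  assumes i: "i = 1" and j: "j = 1" and k: "4 * q dvd k * k - 1" and r: "8 * q dvd r - (1 - 2 * k)"
  shows "metacyclic E e t (8 * q) r"
proof -
  have pow_even: "e [^] (2 * m) = s [^] (k * m)" for m
  proof -
    have "e [^] (2 :: int) = s [^] k"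
      using int_pow_mult[of e 1 1] by (simp add: e_e)
    then show ?thesis
      using int_pow_pow[of e 2 m] int_pow_pow[of s k m] by simp
  qed
  have pow_odd: "e [^] (2 * m + 1) = s [^] (k * m) \<otimes> e" for m
    using int_pow_mult[of e "2 * m" 1] by (simp add: pow_even)
  have s_eq: "s = e [^] (2 * k)"
    using s_pow_cong[OF k] by (simp add: pow_even)
  have pow_cong: "e [^] a = e [^] b" if "8 * q dvd a - b" for a b :: int
  proof -
    obtain c where "a - b = 8 * q * c" using \<open>8 * q dvd a - b\<close> ..
    then have "a - b = 2 * (4 * q * c)" by simp
    then have "e [^] (a - b) = s [^] (k * (4 * q * c))" by (simp only: pow_even)
    also have "\<dots> = \<one>" by (simp add: s_pow_eq_one_iff)
    finally have "e [^] (a - b) = \<one>" .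
    then show ?thesis using int_pow_mult[of e "a - b" b] by simp
  qed
  \<comment> \<open>The inserted \<open>s^(-1) s\<close> completes \<open>t e\<close> to
    \<open>s t e\<close>, which is \<open>e t\<close> because \<open>j = 1\<close>.\<close>
  have "t \<otimes> e = s [^] (- 1 :: int) \<otimes> (s [^] (1 :: int) \<otimes> (t \<otimes> e))"
    by (simp only: s_pow_add' m_closed t_closed e_closed) simp
  also have "\<dots> = s [^] (- 1 :: int) \<otimes> e \<otimes> t"
    using e_t j by (simp add: m_assoc)
  also have "s [^] (- 1 :: int) = s [^] (k * - k)"
    by (rule s_pow_cong) (use k in simp)
  also have "s [^] (k * - k) \<otimes> e = e [^] (2 * - k + 1)"
    by (simp only: pow_odd)
  also have "\<dots> = e [^] r"
    by (rule pow_cong[symmetric]) (use r in \<open>simp add: algebra_simps\<close>)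
  finally have t_e: "t \<otimes> e = e [^] r \<otimes> t" .
  interpret A: metacyclic_relations E e t "8 * q" r
    by unfold_locales (use pow_cong[of "8 * q" 0] in \<open>simp_all add: t_t t_e\<close>)
  interpret A: metacyclic_subgroup E e t "8 * q" r
  proof
    fix a :: int
    have "t = elt (0, True)" by (simp add: elt_def)
    show "8 * q dvd a" if "e [^] a = \<one>"
    \<comment> \<open>Even powers of \<open>e\<close> are rotations in \<open>D\<close>; odd powers
      lie in the other coset and so are neither \<open>\<one>\<close> nor \<open>t\<close>.\<close>
    proof (cases "even a")
      case True
      then obtain m where a: "a = 2 * m" ..
      with that have "4 * q dvd k * m" by (simp add: pow_even s_pow_eq_one_iff)
      then have "4 * q dvd k * (k * m) - (k * k - 1) * m"
        using k by (intro dvd_diff) simp_all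
      then have "4 * q dvd m" by (simp add: algebra_simps)
      then have "2 * (4 * q) dvd 2 * m" by (rule mult_dvd_mono[OF dvd_refl])
      then show ?thesis by (simp add: a)
    next
      case False
      then obtain m where "a = 2 * m + 1" ..
      with that show ?thesis
        using elt_mult_e_neq[of "(k * m, False)" "(0, False)"] by (simp add: pow_odd elt_def)
    qed
    show "t \<noteq> e [^] a"
    proof (cases "even a")
      case True
      then show ?thesis by (auto simp: pow_even t_not_s_pow)
    next
      case False
      then obtain m where "a = 2 * m + 1" ..
      then show ?thesis
        using elt_mult_e_neq[of "(k * m, False)" "(0, True)"] by (simp add: pow_odd elt_def)
    qed
  qed
  interpret H: subgroup "range A.elt" E by (rule A.subgroup_range_elt)
  have e: "e \<in> range A.elt" and t: "t \<in> range A.elt"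
    by (rule range_eqI[of _ _ "(1, False)"], simp add: A.elt_def)
      (rule range_eqI[of _ _ "(0, True)"], simp add: A.elt_def)
  have "s [^] a \<in> range A.elt" for a :: int
    unfolding s_eq by (simp add: e int_pow_pow subgroup_int_pow_closed[OF H.subgroup_axioms])
  with e t have "ext_elt x \<in> range A.elt" for x
    by (auto simp: ext_elt_def elt_def split: prod.split)
  then have "carrier E \<subseteq> range A.elt"
    unfolding carrier_ext by (rule image_subsetI)
  then have "carrier E = range A.elt"
    using H.subset by (rule subset_antisym)
  then show ?thesis by unfold_locales
qed

end

lemma dihedral_gens_closed:
  assumes "dihedral_gens d E D s t"
  shows "s \<in> D" "t \<in> D"
proof -
  interpret metacyclic "dihedral_group d" "dihedral_gen d S" "dihedral_gen d T" "2 ^ (d - 1)" "- 1"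
    by (rule metacyclic_dihedral_group)
  obtain \<phi> where "\<phi> \<in> iso (dihedral_group d) (E\<lparr>carrier := D\<rparr>)"
    "s = \<phi> (dihedral_gen d S)" "t = \<phi> (dihedral_gen d T)"
    using assms by (auto simp: dihedral_gens_def)
  then show "s \<in> D" "t \<in> D"
    using s_closed t_closed by (auto simp: iso_def hom_def)
qed

context
  fixes d :: nat and q :: int
  assumes d: "3 \<le> d" and q: "q = 2 ^ (d - 3)"
begin

lemma s_pow_half: "s [^]\<^bsub>E\<^esub> ((2::nat) ^ (d - 2)) = s [^]\<^bsub>E\<^esub> (2 * q)"
  unfolding order_half[OF d q, symmetric] by (rule int_pow_int[symmetric])

lemma not_mem_complement:
  assumes "degree_2_extension E D" "carrier E = D <#>\<^bsub>E\<^esub> generate E {e}" "e \<in> carrier E"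
  shows "e \<notin> D"
proof
  interpret group E using assms(1) by (simp add: degree_2_extension_def)
  interpret D: subgroup D E using assms(1) by (simp add: degree_2_extension_def)
  assume "e \<in> D"
  then have "generate E {e} \<subseteq> D"
    by (intro generate_subgroup_incl) (simp_all add: D.subgroup_axioms)
  with assms(2) have "carrier E \<subseteq> D" by (auto simp: set_mult_def)
  with assms(1) index_two_iff[OF is_group D.subgroup_axioms] show False by blast
qed

lemma type_a_eq: "type_a d = normal_form q (1, 0, 0)"
proof (intro subset_antisym subrelI)
  fix E :: "'a monoid" and D assume "(E, D) \<in> type_a d"
  then obtain e where ED: "(E, D) \<in> dihedral_extensions d" and e: "e \<in> centralizer E D"
    "e [^]\<^bsub>E\<^esub> (2::nat) = \<one>\<^bsub>E\<^esub>" "internal_direct_product E D (generate E {e})"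
    by (auto simp: type_a_def)
  \<comment> \<open>Any dihedral generating pair will do, since \<open>e\<close> centralizes all of
    \<open>D\<close>.\<close>
  obtain s t where ext: "degree_2_extension E D" and gens: "dihedral_gens d E D s t"
    using ED unfolding dihedral_extensions_iff by blast
  interpret group E using ext by (simp add: degree_2_extension_def)
  interpret D: subgroup D E using ext by (simp add: degree_2_extension_def)
  have st: "s \<in> D" "t \<in> D" "s \<in> carrier E" "t \<in> carrier E"
    using dihedral_gens_closed[OF gens] D.subset by auto
  have e_closed: "e \<in> carrier E" and comm: "\<And>x. x \<in> D \<Longrightarrow> e \<otimes>\<^bsub>E\<^esub> x = x \<otimes>\<^bsub>E\<^esub> e"
    using e(1) by (auto simp: centralizer_def)
  have "carrier E = (\<lambda>(a, b). a \<otimes>\<^bsub>E\<^esub> b) ` (D \<times> generate E {e})"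
    using e(3) by (auto simp: internal_direct_product_def iso_def bij_betw_def DirProd_def)
  also have "\<dots> = D <#>\<^bsub>E\<^esub> generate E {e}"
    by (auto simp: set_mult_def)
  finally have "e \<notin> D" by (rule not_mem_complement[OF ext _ e_closed])
  then show "(E, D) \<in> normal_form q (1, 0, 0)"
    by (rule normal_formI[OF d q ext gens e_closed])
      (use e e_closed st in \<open>simp_all add: comm nat_pow_square\<close>)
next
  fix E :: "'a monoid" and D assume "(E, D) \<in> normal_form q (1, 0, 0)"
  then obtain s t e where ext: "dihedral_extension E s t q e 1 0 0"
    and D: "D = range (metacyclic_relations.elt E s t)" and "(E, D) \<in> dihedral_extensions d"
    by (rule normal_formE[OF d q])
  interpret dihedral_extension E s t q e 1 0 0 by (rule ext)
  have "e \<in> centralizer E D"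
    using e_central subgroup.subset[OF subgroup_range_elt] by (auto simp: centralizer_def D)
  moreover have "e \<otimes>\<^bsub>E\<^esub> e = \<one>\<^bsub>E\<^esub>" using e_e by simp
  moreover have "internal_direct_product E D (generate E {e})"
    by (rule internal_direct_product_involution)
      (use calculation e_notin carrier_E subgroup_range_elt is_group in \<open>simp_all add: D\<close>)
  ultimately show "(E, D) \<in> type_a d"
    using \<open>(E, D) \<in> dihedral_extensions d\<close> nat_pow_square[OF e_closed]
    unfolding type_a_def by auto
qed

lemma type_b_eq: "type_b d = normal_form q (1, 0, 2 * q)"
proof (intro subset_antisym subrelI)
  fix E :: "'a monoid" and D assume "(E, D) \<in> type_b d"
  then obtain s t e where ED: "(E, D) \<in> dihedral_extensions d" and gens: "dihedral_gens d E D s t"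
    and e: "e \<in> centralizer E D" "carrier E = D <#>\<^bsub>E\<^esub> generate E {e}"
    "e [^]\<^bsub>E\<^esub> (2::nat) = s [^]\<^bsub>E\<^esub> (2 * q)"
    by (auto simp: type_b_def s_pow_half)
  have ext: "degree_2_extension E D"
    using ED unfolding dihedral_extensions_iff by blast
  interpret group E using ext by (simp add: degree_2_extension_def)
  interpret D: subgroup D E using ext by (simp add: degree_2_extension_def)
  have st: "s \<in> D" "t \<in> D" "s \<in> carrier E" "t \<in> carrier E"
    using dihedral_gens_closed[OF gens] D.subset by auto
  have e_closed: "e \<in> carrier E" and comm: "\<And>x. x \<in> D \<Longrightarrow> e \<otimes>\<^bsub>E\<^esub> x = x \<otimes>\<^bsub>E\<^esub> e"
    using e(1) by (auto simp: centralizer_def)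
  show "(E, D) \<in> normal_form q (1, 0, 2 * q)"
    by (rule normal_formI[OF d q ext gens e_closed not_mem_complement[OF ext e(2) e_closed]])
      (use e e_closed st in \<open>simp_all add: comm nat_pow_square\<close>)
next
  fix E :: "'a monoid" and D assume "(E, D) \<in> normal_form q (1, 0, 2 * q)"
  then obtain s t e where ext: "dihedral_extension E s t q e 1 0 (2 * q)"
    and D: "D = range (metacyclic_relations.elt E s t)" and "dihedral_gens d E D s t"
    and "(E, D) \<in> dihedral_extensions d"
    by (rule normal_formE[OF d q])
  interpret dihedral_extension E s t q e 1 0 "2 * q" by (rule ext)
  have "e \<in> centralizer E D"
    using e_central subgroup.subset[OF subgroup_range_elt] by (auto simp: centralizer_def D)
  then show "(E, D) \<in> type_b d"
    using \<open>(E, D) \<in> dihedral_extensions d\<close> \<open>dihedral_gens d E D s t\<close> e_e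
      carrier_eq_set_mult[folded D] nat_pow_square[OF e_closed]
    unfolding type_b_def s_pow_half by auto
qed

lemma type_e_eq: "type_e d = normal_form q (1 + 2 * q, 0, 0)"
proof (intro subset_antisym subrelI)
  fix E :: "'a monoid" and D assume "(E, D) \<in> type_e d"
  then obtain s t e where ED: "(E, D) \<in> dihedral_extensions d" and gens: "dihedral_gens d E D s t"
    and e: "e \<in> carrier E" "internal_semidirect_product E D (generate E {e})"
      "e [^]\<^bsub>E\<^esub> (2::nat) = \<one>\<^bsub>E\<^esub>"
      "conj_by E s e = s [^]\<^bsub>E\<^esub> (2 * q) \<otimes>\<^bsub>E\<^esub> s" "conj_by E t e = t"
    by (auto simp: type_e_def s_pow_half)
  have ext: "degree_2_extension E D"
    using ED unfolding dihedral_extensions_iff by blast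
  interpret group E using ext by (simp add: degree_2_extension_def)
  interpret D: subgroup D E using ext by (simp add: degree_2_extension_def)
  have st: "s \<in> carrier E" "t \<in> carrier E"
    using dihedral_gens_closed[OF gens] D.subset by auto
  have e_e: "e \<otimes>\<^bsub>E\<^esub> e = \<one>\<^bsub>E\<^esub>"
    using e(1,3) by (simp add: nat_pow_square)
  then have inv_e: "inv\<^bsub>E\<^esub> e = e" using e(1) by (simp add: inv_equality)
  \<comment> \<open>The type is stated with \<open>e^(-1) x e\<close>, the normal form with
    \<open>e x e^(-1)\<close>; for an involution they agree.\<close>
  have conj: "e \<otimes>\<^bsub>E\<^esub> x = conj_by E x e \<otimes>\<^bsub>E\<^esub> e" if "x \<in> carrier E" for x
    using that e(1) e_e by (simp add: conj_by_def inv_e m_assoc)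
  have "s [^]\<^bsub>E\<^esub> (2 * q) \<otimes>\<^bsub>E\<^esub> s = s [^]\<^bsub>E\<^esub> (1 + 2 * q)"
    using st int_pow_mult[of s "2 * q" 1] by (simp add: add.commute)
  moreover have "e \<notin> D"
    using e(2) by (intro not_mem_complement[OF ext _ e(1)]) (simp add: internal_semidirect_product_def)
  ultimately show "(E, D) \<in> normal_form q (1 + 2 * q, 0, 0)"
    using conj[OF st(1)] conj[OF st(2)] st e e_e
    by (intro normal_formI[OF d q ext gens e(1)]) simp_all
next
  fix E :: "'a monoid" and D assume "(E, D) \<in> normal_form q (1 + 2 * q, 0, 0)"
  then obtain s t e where ext: "dihedral_extension E s t q e (1 + 2 * q) 0 0"
    and D: "D = range (metacyclic_relations.elt E s t)" and gens: "dihedral_gens d E D s t"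
    and deg: "degree_2_extension E D" and ED: "(E, D) \<in> dihedral_extensions d"
    by (rule normal_formE[OF d q])
  interpret dihedral_extension E s t q e "1 + 2 * q" 0 0 by (rule ext)
  have e2: "e \<otimes>\<^bsub>E\<^esub> e = \<one>\<^bsub>E\<^esub>" using e_e by simp
  then have inv_e: "inv\<^bsub>E\<^esub> e = e" by (simp add: inv_equality)
  have gen: "generate E {e} = {\<one>\<^bsub>E\<^esub>, e}" by (rule generate_involution[OF e_closed e2])
  have "conj_by E s e = s [^]\<^bsub>E\<^esub> (2 * q) \<otimes>\<^bsub>E\<^esub> s"
    using int_pow_mult[of s "2 * q" 1]
    by (simp add: conj_by_def inv_e e_s m_assoc e2 add.commute)
  moreover have "conj_by E t e = t"
    by (simp add: conj_by_def inv_e e_t m_assoc e2)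
  moreover have "internal_semidirect_product E D (generate E {e})"
    unfolding internal_semidirect_product_def
  proof (intro conjI)
    show "D \<lhd> E" by (rule index_two_normal[OF deg])
    show "subgroup (generate E {e}) E" by (rule generate_is_subgroup) simp
    show "D <#>\<^bsub>E\<^esub> generate E {e} = carrier E"
      unfolding D by (rule carrier_eq_set_mult[symmetric])
    show "D \<inter> generate E {e} = {\<one>\<^bsub>E\<^esub>}"
      unfolding gen D using e_notin subgroup.one_closed[OF subgroup_range_elt] by blast
  qed
  ultimately show "(E, D) \<in> type_e d"
    using ED gens e_closed nat_pow_square[OF e_closed, unfolded e2]
    unfolding type_e_def s_pow_half mem_Collect_eq case_prod_conv by blast
qed

text \<open>An extension with \<open>E \<cong> M\<close> might a priori have its subgroup
  \<open>D\<close> placed so as to yield another triple. Comparison with a sample member of the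
  normal form and uniqueness of the triple exclude this.\<close>

lemma normal_form_iso_class:
  assumes inf: "infinite (UNIV :: 'a set)" and p: "p \<in> dihedral_parameters q" and "group M"
    and M: "\<And>(E :: 'a monoid) D. (E, D) \<in> normal_form q p \<Longrightarrow> E \<cong> M"
  shows "{(E, D) \<in> dihedral_extensions d. E \<cong> M} = (normal_form q p :: ('a monoid \<times> 'a set) set)"
proof (intro subset_antisym subrelI)
  fix E :: "'a monoid" and D assume "(E, D) \<in> {(E, D) \<in> dihedral_extensions d. E \<cong> M}"
  then have ED: "(E, D) \<in> dihedral_extensions d" and "E \<cong> M" by auto
  obtain p' where p': "p' \<in> dihedral_parameters q" "(E, D) \<in> normal_form q p'"
    by (rule normal_form_cover[OF d q ED])
  obtain E' :: "'a monoid" and D' where E': "(E', D') \<in> normal_form q p"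
    using normal_form_nonempty[OF d q inf p] by auto
  then obtain s t e where "dihedral_extension E' s t q e (fst p) (fst (snd p)) (snd (snd p))"
    by (auto simp: normal_form_def)
  then interpret E': dihedral_extension E' s t q e "fst p" "fst (snd p)" "snd (snd p)" .
  have "E \<cong> E'"
    using \<open>E \<cong> M\<close> E'.iso_sym[OF M[OF E']] by (rule iso_trans)
  with normal_form_unique[OF d q p'(2,1) E' p] p'(2) show "(E, D) \<in> normal_form q p" by simp
next
  fix E :: "'a monoid" and D assume "(E, D) \<in> normal_form q p"
  with M normal_form_subset[OF d q, of p] show "(E, D) \<in> {(E, D) \<in> dihedral_extensions d. E \<cong> M}"
    by auto
qed

lemma type_c_eq:
  assumes "infinite (UNIV :: 'a set)"
  shows "type_c d = (normal_form q (1, 1, 1) :: ('a monoid \<times> 'a set) set)"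
  unfolding type_c_def
proof (rule normal_form_iso_class[OF assms])
  show "group (dihedral_group (d + 1))"
    unfolding dihedral_group_def by (rule group_presented_group)
  fix E :: "'a monoid" and D assume "(E, D) \<in> normal_form q (1, 1, 1)"
  then obtain s t e where "dihedral_extension E s t q e 1 1 1"
    by (auto simp: normal_form_def)
  then interpret dihedral_extension E s t q e 1 1 1 .
  have "metacyclic E e t (8 * q) (- 1)"
    by (rule metacyclic_complement) simp_all
  moreover have "(2 :: int) ^ (d + 1 - 1) = 8 * q"
    using order_rotation[OF d q] d by (cases d) simp_all
  ultimately have "metacyclic E e t (2 ^ (d + 1 - 1)) (- 1)" by simp
  from metacyclic_iso[OF this metacyclic_dihedral_group] show "E \<cong> dihedral_group (d + 1)"
    by (metis is_isoI)
qed (simp add: dihedral_parameters_def)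

lemma type_d_eq:
  assumes "infinite (UNIV :: 'a set)"
  shows "type_d d = (normal_form q (1, 1, 1 + 2 * q) :: ('a monoid \<times> 'a set) set)"
  unfolding type_d_def
proof (rule normal_form_iso_class[OF assms])
  show "group (semidihedral_group (d + 1))"
    unfolding semidihedral_group_def by (rule group_presented_group)
  fix E :: "'a monoid" and D assume "(E, D) \<in> normal_form q (1, 1, 1 + 2 * q)"
  then obtain s t e where "dihedral_extension E s t q e 1 1 (1 + 2 * q)"
    by (auto simp: normal_form_def)
  then interpret dihedral_extension E s t q e 1 1 "1 + 2 * q" .
  have sq: "(1 + 2 * q) * (1 + 2 * q) - 1 = 4 * q * (1 + q)"
    by (simp add: algebra_simps)
  \<comment> \<open>For \<open>k = 1 + 2q\<close> one has \<open>1 - 2k = - 1 - 4q\<close>, which is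
    \<open>4q - 1\<close> modulo \<open>8q\<close>: the semidihedral exponent.\<close>
  have "metacyclic E e t (8 * q) (4 * q - 1)"
    by (rule metacyclic_complement) (simp_all add: sq)
  moreover have "(2 :: int) ^ (d + 1 - 1) = 8 * q" "(2 :: int) ^ (d + 1 - 2) = 4 * q"
    using order_rotation[OF d q] d by (cases d; simp)+
  ultimately have E: "metacyclic E e t (2 ^ (d + 1 - 1)) (2 ^ (d + 1 - 2) - 1)" by simp
  obtain s' t' where SD: "metacyclic (semidihedral_group (d + 1)) s' t'
      (2 ^ (d + 1 - 1)) (2 ^ (d + 1 - 2) - 1)"
    by (rule metacyclic_semidihedral_group[of "d + 1"]) (use d in simp)
  from metacyclic_iso[OF E SD] show "E \<cong> semidihedral_group (d + 1)"
    by (metis is_isoI)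
qed (simp add: dihedral_parameters_def)

end

text \<open>Commuting with \<open>s\<close> excludes reflections because \<open>4q\<close> does not
  divide 2; commuting with \<open>t\<close> forces \<open>4q\<close> to divide \<open>2a\<close>, so
  only powers of the half turn remain.\<close>

lemma metacyclic_dihedral_center:
  fixes G :: "'a monoid" (structure)
  assumes "metacyclic G s t (4 * q) (- 1)" "0 < q"
  shows "centralizer G (carrier G) = generate G {s [^] (2 * q)}"
proof -
  interpret metacyclic G s t "4 * q" "- 1" by fact
  have gen: "generate G {s [^] (2 * q)} = range (\<lambda>m :: int. s [^] (2 * q * m))"
    by (auto simp: generate_pow int_pow_pow)
  show ?thesis
    unfolding gen
  proof (intro subset_antisym subsetI)
    fix z assume "z \<in> centralizer G (carrier G)"
    then have z: "z \<in> carrier G" and comm: "\<And>x. z \<otimes> elt x = elt x \<otimes> z"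
      by (auto simp: centralizer_def elt_closed)
    obtain a b where ab: "z = elt (a, b)" using z by (auto simp: carrier_eq)
    have "\<not> b"
      using comm[of "(1, False)"] zdvd_imp_le[of "4 * q" 2] \<open>0 < q\<close>
      by (auto simp: ab elt_mult elt_eq_iff)
    have "2 * (2 * q) dvd 2 * a"
      using comm[of "(0, True)"] \<open>\<not> b\<close> by (simp add: ab elt_mult elt_eq_iff)
    then have "2 * q dvd a" by (subst (asm) dvd_mult_cancel_left) simp
    then obtain m where "a = 2 * q * m" ..
    then show "z \<in> range (\<lambda>m :: int. s [^] (2 * q * m))"
      using \<open>\<not> b\<close> by (simp add: ab elt_def)
  next
    fix z assume "z \<in> range (\<lambda>m :: int. s [^] (2 * q * m))"
    then obtain m :: int where "z = s [^] (2 * q * m)" by blast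
    then have "z = elt (2 * q * m, False)" by (simp add: elt_def)
    then show "z \<in> centralizer G (carrier G)"
      by (auto simp: centralizer_def carrier_eq elt_mult elt_eq_iff elt_closed)
  qed
qed

theorem proposition4p1:
  assumes "infinite (UNIV :: 'a set)"
  shows "card (extension_classes 3 :: ('a monoid \<times> 'a set) set set) = 4 \<and>
    (\<forall>d\<ge>4.
      card (extension_classes d :: ('a monoid \<times> 'a set) set set) = 5 \<and>
      (extension_classes d :: ('a monoid \<times> 'a set) set set) =
        {type_a d, type_b d, type_c d, type_d d, type_e d} \<and>
      centralizer (dihedral_group d) (carrier (dihedral_group d)) =
        generate (dihedral_group d)
          {dihedral_gen d S [^]\<^bsub>dihedral_group d\<^esub> ((2::nat) ^ (d - 2))})"
proof (intro conjI allI impI)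
  \<comment> \<open>The case \<open>d = 3\<close> is \<open>q = 1\<close>, which is odd, so only
    four triples are present.\<close>
  have "card (extension_classes 3 :: ('a monoid \<times> 'a set) set set) = card (dihedral_parameters 1)"
    using extension_classes_eq[of 3 1, OF _ _ assms] by (simp add: card_image)
  then show "card (extension_classes 3 :: ('a monoid \<times> 'a set) set set) = 4"
    by (simp add: dihedral_parameters_def)
next
  fix d :: nat assume "4 \<le> d"
  then have d: "3 \<le> d" by simp
  define q :: int where "q = 2 ^ (d - 3)"
  note classes = extension_classes_eq[OF d q_def assms]
  have "even q" using \<open>4 \<le> d\<close> by (simp add: q_def)
  moreover have "0 < q" by (simp add: q_def)
  ultimately show "card (extension_classes d :: ('a monoid \<times> 'a set) set set) = 5"
    using classes by (simp add: card_image dihedral_parameters_def)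
  show "(extension_classes d :: ('a monoid \<times> 'a set) set set) =
      {type_a d, type_b d, type_c d, type_d d, type_e d}"
    unfolding classes type_a_eq[OF d q_def] type_b_eq[OF d q_def] type_c_eq[OF d q_def assms]
      type_d_eq[OF d q_def assms] type_e_eq[OF d q_def]
    using \<open>even q\<close> by (auto simp: dihedral_parameters_def)
  show "centralizer (dihedral_group d) (carrier (dihedral_group d)) =
      generate (dihedral_group d)
        {dihedral_gen d S [^]\<^bsub>dihedral_group d\<^esub> ((2::nat) ^ (d - 2))}"
    unfolding s_pow_half[OF d q_def]
    by (rule metacyclic_dihedral_center[OF
          metacyclic_dihedral_group[of d, unfolded order_rotation[OF d q_def]] \<open>0 < q\<close>])
qed

end
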